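(* Assume $rs^{-1}$ is not a root of unity. Let $M$ be a nonzero finite-dimensional $\widetilde U$-module (where $\widetilde U=U_{r,s}(\mathfrak{gl}_n)$) on which $\widetilde U^0$ acts semisimply. Then $M$ is completely reducible.
   Context: $\mathbb K$ is an algebraically closed field, $n$ a positive integer, $r,s\in\mathbb K$ nonzero with $r\ne s$. Let $\epsilon_1,\dots,\epsilon_n$ be an orthonormal basis of a Euclidean space with inner product $\langle\ ,\ \rangle$, and $\alpha_j=\epsilon_j-\epsilon_{j+1}$ ($1\le j<n$). $\widetilde U=U_{r,s}(\mathfrak{gl}_n)$ is the unital associative $\mathbb K$-algebra generated by $e_j,f_j$ ($1\le j<n$) and $a_i^{\pm1},b_i^{\pm1}$ ($1\le i\le n$) with relations: (R1) the $a_i^{\pm1},b_j^{\pm1}$ all commute and $a_ia_i^{-1}=b_jb_j^{-1}=1$; (R2) $a_ie_j=r^{\langle\epsilon_i,\alpha_j\rangle}e_ja_i$, $a_if_j=r^{-\langle\epsilon_i,\alpha_j\rangle}f_ja_i$; (R3) $b_ie_j=s^{\langle\epsilon_i,\alpha_j\rangle}e_jb_i$, $b_if_j=s^{-\langle\epsilon_i,\alpha_j\rangle}f_jb_i$; (R4) $[e_i,f_j]=\frac{\delta_{i,j}}{r-s}(a_ib_{i+1}-a_{i+1}b_i)$; (R5) $[e_i,e_j]=[f_i,f_j]=0$ if $|i-j|>1$; (R6) $e_i^2e_{i+1}-(r+s)e_ie_{i+1}e_i+rs\,e_{i+1}e_i^2=0$ and $e_ie_{i+1}^2-(r+s)e_{i+1}e_ie_{i+1}+rs\,e_{i+1}^2e_i=0$;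 (R7) $f_i^2f_{i+1}-(r^{-1}+s^{-1})f_if_{i+1}f_i+r^{-1}s^{-1}f_{i+1}f_i^2=0$ and $f_if_{i+1}^2-(r^{-1}+s^{-1})f_{i+1}f_if_{i+1}+r^{-1}s^{-1}f_{i+1}^2f_i=0$. $\widetilde U^0$ is the (commutative) subalgebra generated by all $a_i^{\pm1},b_i^{\pm1}$. It acts semisimply on $M$ if $M$ is the direct sum of its simultaneous (genuine) eigenspaces $\{m\in M: am=\chi(a)m\ \forall a\in\widetilde U^0\}$ over algebra homomorphisms $\chi:\widetilde U^0\to\mathbb K$. *)

theory Defs
  imports
    "HOL-Library.Poly_Mapping"
    "HOL-Library.FuncSet"
    "HOL-Algebra.QuotRing"
    "HOL-Algebra.Generated_Rings"
    "HOL-Algebra.Algebraic_Closure_Type"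
begin

section \<open>Free algebras\<close>

text \<open>
  The free monoid on \<open>'g\<close>, written additively because the convolution product of
  \<^theory>\<open>HOL-Library.Poly_Mapping\<close> expects an additive (not necessarily commutative) monoid of
  exponents. Thus \<open>'g fmon \<Rightarrow>\<^sub>0 'k\<close> is the free associative algebra on \<open>'g\<close> over \<open>'k\<close>.
\<close>

datatype 'g fmon = Word (letters: "'g list")

instantiation fmon :: (type) monoid_add
begin

definition zero_fmon :: "'a fmon" where "0 = Word []"

definition plus_fmon :: "'a fmon \<Rightarrow> 'a fmon \<Rightarrow> 'a fmon"
  where "u + v = Word (letters u @ letters v)"

instance
  by standard (simp_all add: zero_fmon_def plus_fmon_def)

end

definition free_gen :: "'g \<Rightarrow> ('g fmon \<Rightarrow>\<^sub>0 'k::ring_1)"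
  where "free_gen g = Poly_Mapping.single (Word [g]) 1"

definition free_const :: "'k \<Rightarrow> ('g fmon \<Rightarrow>\<^sub>0 'k::ring_1)"
  where "free_const c = Poly_Mapping.single 0 c"

text \<open>The free algebra on a set \<open>G\<close> of generators.\<close>

definition free_alg :: "'g set \<Rightarrow> ('g fmon \<Rightarrow>\<^sub>0 'k::ring_1) ring"
  where "free_alg G = ring_of_type_algebra
    \<lparr>carrier := {p. \<forall>w \<in> Poly_Mapping.keys p. set (letters w) \<subseteq> G}\<rparr>"


section \<open>The two-parameter quantum group of gl(n)\<close>

text \<open>The elements written \<open>\<epsilon>\<^sub>i\<close>, \<open>\<alpha>\<^sub>j\<close> in coordinates with respect to the orthonormal basis
  \<open>\<epsilon>\<^sub>1, \<dots>, \<epsilon>\<^sub>n\<close>; all inner products that occur are integers.\<close>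

definition eps :: "nat \<Rightarrow> nat \<Rightarrow> int"
  where "eps i = (\<lambda>k. if k = i then 1 else 0)"

definition alpha :: "nat \<Rightarrow> nat \<Rightarrow> int"
  where "alpha j = (\<lambda>k. eps j k - eps (j + 1) k)"

definition ip :: "nat \<Rightarrow> (nat \<Rightarrow> int) \<Rightarrow> (nat \<Rightarrow> int) \<Rightarrow> int"
  where "ip n x y = (\<Sum>k = 1..n. x k * y k)"

datatype gen = GE nat | GF nat | GA nat | GAinv nat | GB nat | GBinv nat

definition torus_gens :: "nat \<Rightarrow> gen set"
  where "torus_gens n = GA ` {1..n} \<union> GAinv ` {1..n} \<union> GB ` {1..n} \<union> GBinv ` {1..n}"

definition gens :: "nat \<Rightarrow> gen set"
  where "gens n = GE ` {1..<n} \<union> GF ` {1..<n} \<union> torus_gens n"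

type_synonym 'k free_gl = "gen fmon \<Rightarrow>\<^sub>0 'k"

text \<open>The relations, each given as the element (left-hand side) - (right-hand side).\<close>

definition relators :: "nat \<Rightarrow> 'k::field \<Rightarrow> 'k \<Rightarrow> 'k free_gl set"
  where "relators n r s =
   (let x = free_gen; C = free_const;
        e = (\<lambda>i. x (GE i)); f = (\<lambda>i. x (GF i));
        a = (\<lambda>i. x (GA i)); a' = (\<lambda>i. x (GAinv i));
        b = (\<lambda>i. x (GB i)); b' = (\<lambda>i. x (GBinv i)) in
      {x g * x h - x h * x g | g h. g \<in> torus_gens n \<and> h \<in> torus_gens n}
    \<union> {a i * a' i - 1 | i. i \<in> {1..n}}
    \<union> {b i * b' i - 1 | i. i \<in> {1..n}}
    \<union> {a i * e j - C (r powi ip n (eps i) (alpha j)) * e j * a i | i j. i \<in> {1..n} \<and> j \<in> {1..<n}}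
    \<union> {a i * f j - C (r powi (- ip n (eps i) (alpha j))) * f j * a i | i j. i \<in> {1..n} \<and> j \<in> {1..<n}}
    \<union> {b i * e j - C (s powi ip n (eps i) (alpha j)) * e j * b i | i j. i \<in> {1..n} \<and> j \<in> {1..<n}}
    \<union> {b i * f j - C (s powi (- ip n (eps i) (alpha j))) * f j * b i | i j. i \<in> {1..n} \<and> j \<in> {1..<n}}
    \<union> {(e i * f j - f j * e i)
        - C ((if i = j then 1 else 0) / (r - s)) * (a i * b (i + 1) - a (i + 1) * b i)
       | i j. i \<in> {1..<n} \<and> j \<in> {1..<n}}
    \<union> {e i * e j - e j * e i | i j. i \<in> {1..<n} \<and> j \<in> {1..<n} \<and> \<bar>int i - int j\<bar> > 1}
    \<union> {f i * f j - f j * f i | i j. i \<in> {1..<n} \<and> j \<in> {1..<n} \<and> \<bar>int i - int j\<bar> > 1}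
    \<union> {(e i)^2 * e (i+1) - C (r + s) * e i * e (i+1) * e i + C (r * s) * e (i+1) * (e i)^2
       | i. i \<in> {1..<n} \<and> i + 1 \<in> {1..<n}}
    \<union> {e i * (e (i+1))^2 - C (r + s) * e (i+1) * e i * e (i+1) + C (r * s) * (e (i+1))^2 * e i
       | i. i \<in> {1..<n} \<and> i + 1 \<in> {1..<n}}
    \<union> {(f i)^2 * f (i+1) - C (inverse r + inverse s) * f i * f (i+1) * f i
          + C (inverse r * inverse s) * f (i+1) * (f i)^2
       | i. i \<in> {1..<n} \<and> i + 1 \<in> {1..<n}}
    \<union> {f i * (f (i+1))^2 - C (inverse r + inverse s) * f (i+1) * f i * f (i+1)
          + C (inverse r * inverse s) * (f (i+1))^2 * f i
       | i. i \<in> {1..<n} \<and> i + 1 \<in> {1..<n}})"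

definition rel_ideal :: "nat \<Rightarrow> 'k::field \<Rightarrow> 'k \<Rightarrow> 'k free_gl set"
  where "rel_ideal n r s = genideal (free_alg (gens n)) (relators n r s)"

definition Ugl :: "nat \<Rightarrow> 'k::field \<Rightarrow> 'k \<Rightarrow> 'k free_gl set ring"
  where "Ugl n r s = free_alg (gens n) Quot rel_ideal n r s"

definition Ugl_class :: "nat \<Rightarrow> 'k::field \<Rightarrow> 'k \<Rightarrow> 'k free_gl \<Rightarrow> 'k free_gl set"
  where "Ugl_class n r s p = rel_ideal n r s +>\<^bsub>free_alg (gens n)\<^esub> p"

text \<open>The structure map \<open>\<bbbK> \<rightarrow> U\<close> that makes the ring \<^term>\<open>Ugl n r s\<close> a \<open>\<bbbK>\<close>-algebra.\<close>

definition Ugl_const :: "nat \<Rightarrow> 'k::field \<Rightarrow> 'k \<Rightarrow> 'k \<Rightarrow> 'k free_gl set"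
  where "Ugl_const n r s c = Ugl_class n r s (free_const c)"

definition Ugl0 :: "nat \<Rightarrow> 'k::field \<Rightarrow> 'k \<Rightarrow> 'k free_gl set set"
  where "Ugl0 n r s = generate_ring (Ugl n r s)
    (range (Ugl_const n r s) \<union> (\<lambda>g. Ugl_class n r s (free_gen g)) ` torus_gens n)"

text \<open>\<open>\<bbbK>\<close>-algebra homomorphisms \<open>U\<^sup>0 \<rightarrow> \<bbbK>\<close>. Extensionality makes distinct functions represent
  distinct homomorphisms, so that these functions can index a direct sum.\<close>

definition Ugl0_characters :: "nat \<Rightarrow> 'k::field \<Rightarrow> 'k \<Rightarrow> ('k free_gl set \<Rightarrow> 'k) set"
  where "Ugl0_characters n r s =
    {\<chi> \<in> ring_hom (Ugl n r s \<lparr>carrier := Ugl0 n r s\<rparr>) ring_of_type_algebra.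
       (\<forall>c. \<chi> (Ugl_const n r s c) = c) \<and> \<chi> \<in> extensional (Ugl0 n r s)}"


section \<open>Modules over an algebra\<close>

text \<open>The whole space is the internal direct sum of the subspaces \<open>V i\<close>, \<open>i \<in> I\<close>.\<close>

definition is_direct_sum :: "'i set \<Rightarrow> ('i \<Rightarrow> 'm::ab_group_add set) \<Rightarrow> bool"
  where "is_direct_sum I V \<longleftrightarrow>
    (\<forall>m. \<exists>!x. (\<forall>i\<in>I. x i \<in> V i) \<and> (\<forall>i. i \<notin> I \<longrightarrow> x i = 0) \<and> finite {i. x i \<noteq> 0} \<and>
              m = (\<Sum>i | x i \<noteq> 0. x i))"

text \<open>
  Unital left modules over a possibly noncommutative algebra \<open>A\<close> with structure map \<open>\<eta>\<close>
  (HOL-Algebra only has modules over commutative rings). The module is the whole type \<open>'m\<close>, with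
  its vector space structure \<open>scale\<close>; \<open>act\<close> is meaningful on the carrier of \<open>A\<close> only.
\<close>

locale alg_module = vector_space scale
  for scale :: "'k::field \<Rightarrow> 'm::ab_group_add \<Rightarrow> 'm" +
  fixes A :: "'u ring" and \<eta> :: "'k \<Rightarrow> 'u" and act :: "'u \<Rightarrow> 'm \<Rightarrow> 'm"
  assumes act_add_left: "x \<in> carrier A \<Longrightarrow> y \<in> carrier A \<Longrightarrow> act (x \<oplus>\<^bsub>A\<^esub> y) m = act x m + act y m"
    and act_add_right: "x \<in> carrier A \<Longrightarrow> act x (m + m') = act x m + act x m'"
    and act_mult: "x \<in> carrier A \<Longrightarrow> y \<in> carrier A \<Longrightarrow> act (x \<otimes>\<^bsub>A\<^esub> y) m = act x (act y m)"
    and act_one: "act \<one>\<^bsub>A\<^esub> m = m"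
    and act_const: "act (\<eta> c) m = scale c m"
begin

definition finite_dim :: bool
  where "finite_dim \<longleftrightarrow> (\<exists>B. finite B \<and> span B = UNIV)"

definition is_submodule :: "'m set \<Rightarrow> bool"
  where "is_submodule N \<longleftrightarrow> subspace N \<and> (\<forall>x\<in>carrier A. \<forall>m\<in>N. act x m \<in> N)"

definition simple_submodule :: "'m set \<Rightarrow> bool"
  where "simple_submodule N \<longleftrightarrow>
    is_submodule N \<and> N \<noteq> {0} \<and> (\<forall>N'. is_submodule N' \<and> N' \<subseteq> N \<longrightarrow> N' = {0} \<or> N' = N)"

definition completely_reducible :: bool
  where "completely_reducible \<longleftrightarrow>
    (\<exists>S. (\<forall>N\<in>S. simple_submodule N) \<and> is_direct_sum S (\<lambda>N. N))"

definition eigenspace :: "'u set \<Rightarrow> ('u \<Rightarrow> 'k) \<Rightarrow> 'm set"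
  where "eigenspace T \<chi> = {m. \<forall>x\<in>T. act x m = scale (\<chi> x) m}"

definition acts_semisimply :: "'u set \<Rightarrow> ('u \<Rightarrow> 'k) set \<Rightarrow> bool"
  where "acts_semisimply T \<Omega> \<longleftrightarrow> is_direct_sum \<Omega> (eigenspace T)"

end


section \<open>The presented algebra is a ring\<close>

lemma keys_times_letters:
  fixes p q :: "'g fmon \<Rightarrow>\<^sub>0 'k::ring_1"
  assumes "\<forall>w \<in> Poly_Mapping.keys p. set (letters w) \<subseteq> G"
    and "\<forall>w \<in> Poly_Mapping.keys q. set (letters w) \<subseteq> G"
    and "w \<in> Poly_Mapping.keys (p * q)"
  shows "set (letters w) \<subseteq> G"
proof -
  from assms(3) keys_mult[of p q] obtain u v
    where "u \<in> Poly_Mapping.keys p" "v \<in> Poly_Mapping.keys q" "w = u + v" by blast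
  with assms(1,2) show ?thesis by (auto simp: plus_fmon_def)
qed

lemma ring_free_alg: "ring (free_alg G :: ('g fmon \<Rightarrow>\<^sub>0 'k::ring_1) ring)"
proof (rule ringI)
  have carr: "carrier (free_alg G) = {p :: 'g fmon \<Rightarrow>\<^sub>0 'k. \<forall>w \<in> Poly_Mapping.keys p. set (letters w) \<subseteq> G}"
    and ops: "p \<oplus>\<^bsub>free_alg G\<^esub> q = p + q" "p \<otimes>\<^bsub>free_alg G\<^esub> q = p * q"
    "\<zero>\<^bsub>free_alg G\<^esub> = (0 :: 'g fmon \<Rightarrow>\<^sub>0 'k)" "\<one>\<^bsub>free_alg G\<^esub> = (1 :: 'g fmon \<Rightarrow>\<^sub>0 'k)"
    for p q :: "'g fmon \<Rightarrow>\<^sub>0 'k"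
    by (simp_all add: free_alg_def ring_of_type_algebra_def)
  have add: "p + q \<in> carrier (free_alg G)"
    if "p \<in> carrier (free_alg G)" "q \<in> carrier (free_alg G)" for p q :: "'g fmon \<Rightarrow>\<^sub>0 'k"
    using that Poly_Mapping.keys_add[of p q] unfolding carr by blast
  have mult: "p * q \<in> carrier (free_alg G)"
    if "p \<in> carrier (free_alg G)" "q \<in> carrier (free_alg G)" for p q :: "'g fmon \<Rightarrow>\<^sub>0 'k"
    using that keys_times_letters[of p G q] unfolding carr by blast
  have neg: "\<exists>q \<in> carrier (free_alg G). p + q = 0"
    if "p \<in> carrier (free_alg G)" for p :: "'g fmon \<Rightarrow>\<^sub>0 'k"
    using that unfolding carr by (intro bexI[of _ "- p"]) simp_all
  have zero: "(0 :: 'g fmon \<Rightarrow>\<^sub>0 'k) \<in> carrier (free_alg G)"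
    and one: "(1 :: 'g fmon \<Rightarrow>\<^sub>0 'k) \<in> carrier (free_alg G)"
    by (simp_all add: carr zero_fmon_def)
  show "abelian_group (free_alg G :: ('g fmon \<Rightarrow>\<^sub>0 'k) ring)"
    by (rule abelian_groupI) (simp_all add: ops add neg zero add.assoc add.commute)
  show "Group.monoid (free_alg G :: ('g fmon \<Rightarrow>\<^sub>0 'k) ring)"
    by (rule monoidI) (simp_all add: ops mult one mult.assoc)
  show "(p \<oplus>\<^bsub>free_alg G\<^esub> q) \<otimes>\<^bsub>free_alg G\<^esub> u =
      p \<otimes>\<^bsub>free_alg G\<^esub> u \<oplus>\<^bsub>free_alg G\<^esub> q \<otimes>\<^bsub>free_alg G\<^esub> u"
    and "u \<otimes>\<^bsub>free_alg G\<^esub> (p \<oplus>\<^bsub>free_alg G\<^esub> q) =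
      u \<otimes>\<^bsub>free_alg G\<^esub> p \<oplus>\<^bsub>free_alg G\<^esub> u \<otimes>\<^bsub>free_alg G\<^esub> q" for p q u :: "'g fmon \<Rightarrow>\<^sub>0 'k"
    by (simp_all add: ops algebra_simps)
qed

lemma relators_in_carrier: "relators n r s \<subseteq> carrier (free_alg (gens n))"
proof -
  interpret F: ring "free_alg (gens n) :: 'a free_gl ring" by (rule ring_free_alg)
  let ?C = "carrier (free_alg (gens n) :: 'a free_gl ring)"
  have ops: "p \<oplus>\<^bsub>free_alg (gens n)\<^esub> q = p + q" "p \<otimes>\<^bsub>free_alg (gens n)\<^esub> q = p * q"
    "\<one>\<^bsub>free_alg (gens n)\<^esub> = (1 :: 'a free_gl)" for p q :: "'a free_gl"
    by (simp_all add: free_alg_def ring_of_type_algebra_def)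
  have add: "p + q \<in> ?C" and mult: "p * q \<in> ?C" if "p \<in> ?C" "q \<in> ?C" for p q
    using F.add.m_closed[OF that] F.m_closed[OF that] by (simp_all add: ops)
  have one: "1 \<in> ?C" using F.one_closed by (simp add: ops)
  have uminus: "- p \<in> ?C" if "p \<in> ?C" for p
    using that by (simp add: free_alg_def)
  have diff: "p - q \<in> ?C" if "p \<in> ?C" "q \<in> ?C" for p q
    using add[OF that(1) uminus[OF that(2)]] by simp
  have const: "free_const c \<in> ?C" for c
    by (simp add: free_alg_def free_const_def zero_fmon_def)
  have gen: "free_gen g \<in> ?C" if "g \<in> gens n" for g
    using that by (simp add: free_alg_def free_gen_def)
  have torus: "g \<in> gens n" if "g \<in> torus_gens n" for g
    using that by (simp add: gens_def)
  have gens: "GE j \<in> gens n" "GF j \<in> gens n" if "1 \<le> j" "j < n" for j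
    using that by (auto simp: gens_def)
  have tgens: "GA i \<in> gens n" "GAinv i \<in> gens n" "GB i \<in> gens n" "GBinv i \<in> gens n"
    if "1 \<le> i" "i \<le> n" for i
    using that by (auto simp: gens_def torus_gens_def)
  show ?thesis
    unfolding relators_def Let_def power2_eq_square
    apply (intro Un_least)
    apply (safe)
    apply (intro add diff mult const one gen; simp add: torus gens tgens)+
    done
qed

lemma ideal_rel_ideal: "ideal (rel_ideal n r s) (free_alg (gens n))"
  unfolding rel_ideal_def by (rule ring.genideal_ideal[OF ring_free_alg relators_in_carrier])

lemma ring_Ugl: "ring (Ugl n r s)"
  unfolding Ugl_def by (rule ideal.quotient_is_ring[OF ideal_rel_ideal])

end

theory Submission
  imports Defs "HOL-Library.Function_Algebras"
begin

text \<open>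
  By Weyl's trick, a submodule \<open>N\<close> of \<open>M\<close> has an invariant complement once the module of linear maps
  \<open>M \<rightarrow> N\<close> that act on \<open>N\<close> by a scalar contains an invariant outside the submodule of maps that vanish
  on \<open>N\<close>. So it suffices to lift invariants from a trivial quotient \<open>V / L\<close>. This is done by
  induction on the rank, without Casimir elements: let \<open>m \<notin> L\<close> of weight 0 be killed by \<open>e\<^sub>j, f\<^sub>j\<close> for
  \<open>j < q\<close>, with \<open>e\<^sub>q\<^sup>k\<^sup>+\<^sup>1 m = 0\<close> and \<open>k > 0\<close> least possible. A suitable combination \<open>D \<in> L\<close> of the vectors
  \<open>f\<^sub>i \<dots> f\<^sub>q e\<^sub>i \<dots> e\<^sub>q m\<close> is again killed by these \<open>e\<^sub>j, f\<^sub>j\<close>, and \<open>e\<^sub>q\<^sup>k D = \<delta> e\<^sub>q\<^sup>k m\<close> with a scalar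
  \<open>\<delta>\<close> that is nonzero because \<open>r / s\<close> is not a root of unity. Then \<open>m - D / \<delta>\<close> contradicts the choice of \<open>k\<close>.
\<close>

section \<open>Strings for the rank one subalgebras\<close>

text \<open>The obstacle is that a projection onto \<open>N\<close> can easily be made to commute
  with the torus, but not directly with \<open>e\<^sub>j\<close> and \<open>f\<^sub>j\<close>. It
  has to be corrected by maps vanishing on \<open>N\<close>, under an action on maps whose
  invariants are the equivariant maps. This action sends \<phi> to the sum of
  \<open>u\<^sub>1 \<phi> S(u\<^sub>2)\<close> over the coproduct of \<open>u\<close>, with antipode
  \<open>S(e\<^sub>j) = - \<omega>\<^sub>j\<^sup>-\<^sup>1 e\<^sub>j\<close> and
  \<open>S(f\<^sub>j) = - f\<^sub>j \<omega>'\<^sub>j\<^sup>-\<^sup>1\<close>.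

  The weights of \<open>M\<close> are arbitrary characters, but the operators change the degree of a
  map only by roots. Starting from degree 0, all degrees are integer vectors, and the rank one
  computations meet only powers of \<open>r\<close> and \<open>s\<close>.

  The shape of \<open>D\<close> comes from the natural module: for i \<le> q the vectors
  \<open>e\<^sub>i \<dots> e\<^sub>q m\<close> satisfy the relations of its standard basis under
  \<open>e\<^sub>j, f\<^sub>j\<close> with j < q, and the words
  \<open>f\<^sub>i \<dots> f\<^sub>q\<close> carry the opposite weights in the first q coordinates.
  The products imitate the natural module tensored with its dual, whose invariant line suggests the
  coefficients.\<close>

definition hval :: "'k::field \<Rightarrow> 'k \<Rightarrow> int \<Rightarrow> int \<Rightarrow> 'k"
  where "hval r s x y = (r powi x * s powi y - r powi y * s powi x) / (r - s)"

text \<open>\<open>hval\<close> is the eigenvalue of \<open>[e\<^sub>j, f\<^sub>j]\<close> in a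
  weight with entries \<open>x, y\<close> at \<open>j, j + 1\<close>: a power of
  \<open>r * s\<close> times a two-parameter quantum integer. The sum factors into two such
  integers, so its zeros can be read off.\<close>

lemma hval_sum:
  fixes r s :: "'k::field"
  assumes "r \<noteq> 0" "s \<noteq> 0" "r \<noteq> s"
  shows "(\<Sum>k\<le>N. hval r s (x + int k) (y - int k)) =
    (r ^ Suc N - s ^ Suc N) * (r powi x * s powi (y - int N) - r powi (y - int N) * s powi x) / (r - s)^2"
proof -
  have nz: "r - s \<noteq> 0" using assms by simp
  show ?thesis
  proof (induction N)
    case 0
    then show ?case using nz by (simp add: hval_def power2_eq_square)
  next
    case (Suc N)
    have *: "s powi (y - int N) = s powi (y - int (Suc N)) * s"
      "r powi (y - int N) = r powi (y - int (Suc N)) * r"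
      using assms by (simp_all add: power_int_diff power_int_add)
    have **: "r powi (x + int (Suc N)) = r powi x * r ^ Suc N" "s powi (x + int (Suc N)) = s powi x * s ^ Suc N"
      using assms by (simp_all add: power_int_add del: of_nat_Suc)
    have frac: "z / (r - s) = z * (r - s) / (r - s)^2" for z
      using nz by (simp add: power2_eq_square)
    show ?case
      unfolding sum.atMost_Suc Suc.IH
      unfolding hval_def frac add_divide_distrib[symmetric]
      by (rule arg_cong[where f = "\<lambda>z. z / (r - s)^2"]) (simp add: * ** algebra_simps del: of_nat_Suc)
  qed
qed

lemma hval_minus: "hval r s y x = - hval r s x y"
  by (simp add: hval_def minus_divide_left)

lemma powi_ne_of_not_root:
  fixes r s :: "'k::field"
  assumes "r \<noteq> 0" "s \<noteq> 0" "\<And>k::nat. k > 0 \<Longrightarrow> r ^ k \<noteq> s ^ k"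
  shows "r powi x * s powi y = r powi y * s powi x \<longleftrightarrow> x = y"
proof -
  have less: False if eq: "r powi x * s powi y = r powi y * s powi x" and "x < y" for x y
  proof -
    define d where "d = nat (y - x)"
    have y: "y = x + int d" and d: "d > 0" using \<open>x < y\<close> by (auto simp: d_def)
    have "s ^ d = r ^ d"
      using eq assms(1,2) unfolding y by (simp add: power_int_add)
    then show False using assms(3)[OF d] by simp
  qed
  show ?thesis using less[of x y] less[of y x] by (cases x y rule: linorder_cases) auto
qed

lemma hval_sum_nonzero:
  fixes r s :: "'k::field"
  assumes rs: "r \<noteq> 0" "s \<noteq> 0" and nr: "\<And>k::nat. k > 0 \<Longrightarrow> r ^ k \<noteq> s ^ k" and "y - int N \<noteq> x"
  shows "(\<Sum>k\<le>N. hval r s (x + int k) (y - int k)) \<noteq> 0"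
proof -
  have "r \<noteq> s" using nr[of 1] by simp
  then show ?thesis
    using powi_ne_of_not_root[OF rs nr, of x "y - int N"] nr[of "Suc N"] assms(4)
    by (simp add: hval_sum[OF rs] del: power_Suc)
qed

lemma (in vector_space) module_hom_pow:
  assumes "module_hom scale scale T"
  shows "module_hom scale scale (T ^^ k)"
proof (induction k)
  case 0
  show ?case by (simp add: id_def module_hom_iff_linear linear_ident)
next
  case (Suc k)
  show ?case unfolding funpow.simps by (rule module_hom_compose[OF Suc assms])
qed

text \<open>\<open>P\<close> raises and \<open>Q\<close> lowers along a string. Moving
  \<open>Q\<close> through the powers of \<open>P\<close> collects one commutator scalar per
  step.\<close>

lemma (in vector_space) string_step:
  assumes P: "module_hom scale scale P" and Q: "module_hom scale scale Q"
    and PQ: "\<And>k. Q (P ((P ^^ k) x)) = P (Q ((P ^^ k) x)) - scale (c k) ((P ^^ k) x)"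
  shows "Q ((P ^^ Suc N) x) = (P ^^ Suc N) (Q x) - scale (\<Sum>k\<le>N. c k) ((P ^^ N) x)"
proof (induction N)
  case 0
  then show ?case using PQ[of 0] by simp
next
  case (Suc N)
  have "Q ((P ^^ Suc (Suc N)) x) = P (Q ((P ^^ Suc N) x)) - scale (c (Suc N)) ((P ^^ Suc N) x)"
    using PQ[of "Suc N"] by (simp only: funpow.simps o_apply)
  also have "\<dots> = P ((P ^^ Suc N) (Q x)) - scale (\<Sum>k\<le>N. c k) (P ((P ^^ N) x)) - scale (c (Suc N)) ((P ^^ Suc N) x)"
    unfolding Suc.IH by (simp only: module_hom.diff[OF P] module_hom.scale[OF P])
  finally show ?case by (simp add: scale_left_distrib diff_diff_eq add.commute)
qed

text \<open>Let \<open>(P ^^ N) x\<close> be the last nonzero vector of the string. Applying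
  \<open>Q\<close> one step above it leaves, by \<open>string_step\<close>, only the accumulated
  scalar times this vector, so the scalar vanishes and N = d.\<close>

lemma (in vector_space) string_terminates:
  assumes P: "module_hom scale scale P" and Q: "module_hom scale scale Q"
    and PQ: "\<And>k. Q (P ((P ^^ k) x)) = P (Q ((P ^^ k) x)) - scale (c k) ((P ^^ k) x)"
    and Qx: "Q x = 0" and nil: "\<exists>k. (P ^^ k) x = 0"
    and c: "\<And>N. N \<noteq> d \<Longrightarrow> (\<Sum>k\<le>N. c k) \<noteq> 0"
  shows "(P ^^ Suc d) x = 0"
proof -
  have P0: "(P ^^ k) 0 = 0" for k
    by (induction k) (simp_all add: module_hom.zero[OF P])
  define M where "M = (LEAST k. (P ^^ k) x = 0)"
  have M: "(P ^^ M) x = 0" using LeastI_ex[OF nil] by (simp add: M_def)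
  show ?thesis
  proof (cases M)
    case 0
    then show ?thesis using M P0[of "Suc d"] by simp
  next
    case (Suc N)
    have ne: "(P ^^ N) x \<noteq> 0" using not_less_Least[of N "\<lambda>k. (P ^^ k) x = 0"] Suc by (simp add: M_def)
    have "scale (\<Sum>k\<le>N. c k) ((P ^^ N) x) = 0"
      using string_step[OF P Q PQ, of N] M P0[of "Suc N"] unfolding Suc Qx
      by (simp add: module_hom.zero[OF Q])
    then have "(\<Sum>k\<le>N. c k) = 0" using ne by (metis scale_eq_0_iff)
    then have "N = d" using c by blast
    then show ?thesis using M Suc by simp
  qed
qed

section \<open>Lifting invariants from a trivial quotient\<close>

text \<open>\<open>V \<eta>\<close> plays the role of the space of weight \<open>(r\<^sup>\<eta>, s\<^sup>\<eta>)\<close>, and \<open>L\<close> that of a submodule with trivial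
  quotient.\<close>

locale graded_rep = vector_space scale
  for scale :: "'k::field \<Rightarrow> 'v::ab_group_add \<Rightarrow> 'v" +
  fixes n :: nat and r s :: 'k and V :: "(nat \<Rightarrow> int) \<Rightarrow> 'v set" and E F :: "nat \<Rightarrow> 'v \<Rightarrow> 'v"
    and L :: "'v set"
  assumes r0: "r \<noteq> 0" and s0: "s \<noteq> 0" and rs_pow: "\<And>k::nat. k > 0 \<Longrightarrow> r ^ k \<noteq> s ^ k"
    and subspace_V: "subspace (V \<eta>)" and subspace_L: "subspace L"
    and E_hom: "module_hom scale scale (E j)" and F_hom: "module_hom scale scale (F j)"
    and E_V: "j \<in> {1..<n} \<Longrightarrow> x \<in> V \<eta> \<Longrightarrow> E j x \<in> V (\<eta> + alpha j)"
    and F_V: "j \<in> {1..<n} \<Longrightarrow> x \<in> V \<eta> \<Longrightarrow> F j x \<in> V (\<eta> - alpha j)"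
    and E_L: "j \<in> {1..<n} \<Longrightarrow> x \<in> V \<eta> \<Longrightarrow> E j x \<in> L"
    and F_L: "j \<in> {1..<n} \<Longrightarrow> x \<in> V \<eta> \<Longrightarrow> F j x \<in> L"
    and EF: "i \<in> {1..<n} \<Longrightarrow> j \<in> {1..<n} \<Longrightarrow> x \<in> V \<eta> \<Longrightarrow>
      E i (F j x) = F j (E i x) + (if i = j then scale (hval r s (\<eta> i) (\<eta> (i + 1))) x else 0)"
    and EE: "i \<in> {1..<n} \<Longrightarrow> j \<in> {1..<n} \<Longrightarrow> i + 1 < j \<Longrightarrow> x \<in> V \<eta> \<Longrightarrow> E i (E j x) = E j (E i x)"
    and FF: "i \<in> {1..<n} \<Longrightarrow> j \<in> {1..<n} \<Longrightarrow> i + 1 < j \<Longrightarrow> x \<in> V \<eta> \<Longrightarrow> F i (F j x) = F j (F i x)"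
    and Serre: "1 \<le> i \<Longrightarrow> i + 1 < n \<Longrightarrow> x \<in> V \<eta> \<Longrightarrow>
      E i (E (i+1) (E (i+1) x)) - scale (r + s) (E (i+1) (E i (E (i+1) x)))
        + scale (r * s) (E (i+1) (E (i+1) (E i x))) = 0"
    and E_nil: "j \<in> {1..<n} \<Longrightarrow> x \<in> V \<eta> \<Longrightarrow> \<exists>k. (E j ^^ k) x = 0"
    and F_nil: "j \<in> {1..<n} \<Longrightarrow> x \<in> V \<eta> \<Longrightarrow> \<exists>k. (F j ^^ k) x = 0"
begin

lemma rs_ne: "r \<noteq> s" using rs_pow[of 1] by simp

lemmas E_simps [simp] = module_hom.add[OF E_hom] module_hom.diff[OF E_hom] module_hom.zero[OF E_hom]
  module_hom.scale[OF E_hom]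
lemmas F_simps [simp] = module_hom.add[OF F_hom] module_hom.diff[OF F_hom] module_hom.zero[OF F_hom]
  module_hom.scale[OF F_hom]

lemmas E_pow_hom = module_hom_pow[OF E_hom]

section \<open>Rank one strings of graded vectors\<close>

lemma E_pow_V: "j \<in> {1..<n} \<Longrightarrow> x \<in> V \<eta> \<Longrightarrow> (E j ^^ k) x \<in> V (\<lambda>i. \<eta> i + int k * alpha j i)"
proof (induction k)
  case 0
  then show ?case by simp
next
  case (Suc k)
  have "(\<lambda>i. \<eta> i + int k * alpha j i) + alpha j = (\<lambda>i. \<eta> i + int (Suc k) * alpha j i)"
    by (simp add: fun_eq_iff algebra_simps)
  then show ?case using E_V[OF Suc.prems(1) Suc.IH[OF Suc.prems]] by simp
qed

lemma F_pow_V: "j \<in> {1..<n} \<Longrightarrow> x \<in> V \<eta> \<Longrightarrow> (F j ^^ k) x \<in> V (\<lambda>i. \<eta> i - int k * alpha j i)"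
proof (induction k)
  case 0
  then show ?case by simp
next
  case (Suc k)
  have "(\<lambda>i. \<eta> i - int k * alpha j i) - alpha j = (\<lambda>i. \<eta> i - int (Suc k) * alpha j i)"
    by (simp add: fun_eq_iff algebra_simps)
  then show ?case using F_V[OF Suc.prems(1) Suc.IH[OF Suc.prems]] by simp
qed

lemma F_E_pow:
  assumes "j \<in> {1..<n}" "x \<in> V \<eta>"
  shows "F j (E j ((E j ^^ k) x)) = E j (F j ((E j ^^ k) x))
    - scale (hval r s (\<eta> j + int k) (\<eta> (j + 1) - int k)) ((E j ^^ k) x)"
  using EF[OF assms(1) assms(1) E_pow_V[OF assms, of k]] by (simp add: alpha_def eps_def)

lemma E_F_pow:
  assumes "j \<in> {1..<n}" "x \<in> V \<eta>"
  shows "E j (F j ((F j ^^ k) x)) = F j (E j ((F j ^^ k) x))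
    - scale (hval r s (\<eta> (j + 1) + int k) (\<eta> j - int k)) ((F j ^^ k) x)"
  using EF[OF assms(1) assms(1) F_pow_V[OF assms, of k]] hval_minus[of r s "\<eta> j - int k" "\<eta> (j + 1) + int k"]
  by (simp add: alpha_def eps_def)

lemma E_string:
  assumes "j \<in> {1..<n}" "x \<in> V \<eta>" "F j x = 0" "\<eta> (j + 1) = \<eta> j + int d"
  shows "(E j ^^ Suc d) x = 0"
proof (rule string_terminates[OF E_hom F_hom F_E_pow[OF assms(1,2)] assms(3) E_nil[OF assms(1,2)]])
  fix N assume "N \<noteq> d"
  then show "(\<Sum>k\<le>N. hval r s (\<eta> j + int k) (\<eta> (j + 1) - int k)) \<noteq> 0"
    using assms(4) by (intro hval_sum_nonzero r0 s0 rs_pow) auto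
qed

text \<open>With equal weight entries the \<open>F j\<close>-string can only break off at step 0. In
  degree 0, invariance under \<open>E j\<close> therefore already gives invariance under
  \<open>F j\<close>.\<close>

lemma F_eq_0:
  assumes "j \<in> {1..<n}" "x \<in> V \<eta>" "E j x = 0" "\<eta> (j + 1) = \<eta> j"
  shows "F j x = 0"
proof -
  have "(F j ^^ Suc 0) x = 0"
  proof (rule string_terminates[OF F_hom E_hom E_F_pow[OF assms(1,2)] assms(3) F_nil[OF assms(1,2)]])
    fix N :: nat assume "N \<noteq> 0"
    then show "(\<Sum>k\<le>N. hval r s (\<eta> (j + 1) + int k) (\<eta> j - int k)) \<noteq> 0"
      using assms(4) by (intro hval_sum_nonzero r0 s0 rs_pow) auto
  qed
  then show ?thesis by simp
qed

lemma E_eq_0: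
  assumes "j \<in> {1..<n}" "x \<in> V \<eta>" "F j x = 0" "\<eta> (j + 1) = \<eta> j"
  shows "E j x = 0"
  using E_string[of j x \<eta> 0] assms by simp

lemma E_pow_F:
  assumes "j \<in> {1..<n}" "x \<in> V \<eta>"
  shows "(E j ^^ Suc N) (F j x) = F j ((E j ^^ Suc N) x)
    + scale ((r ^ Suc N - s ^ Suc N) * (r powi \<eta> j * s powi (\<eta> (j + 1) - int N)
        - r powi (\<eta> (j + 1) - int N) * s powi \<eta> j) / (r - s)^2) ((E j ^^ N) x)"
  using string_step[OF E_hom F_hom F_E_pow[OF assms], of N] unfolding hval_sum[OF r0 s0 rs_ne]
  by simp

section \<open>Words of consecutive raising or lowering operators\<close>

lemma foldr_commute:
  assumes "\<And>k x \<eta>. k \<in> set ks \<Longrightarrow> x \<in> V \<eta> \<Longrightarrow> T (G k x) = G k (T x)"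
    and "\<And>k x \<eta>. k \<in> set ks \<Longrightarrow> x \<in> V \<eta> \<Longrightarrow> \<exists>\<theta>. G k x \<in> V \<theta>"
    and "x \<in> V \<eta>"
  shows "T (foldr G ks x) = foldr G ks (T x)"
proof -
  have "T (foldr G ks x) = foldr G ks (T x) \<and> (\<exists>\<theta>. foldr G ks x \<in> V \<theta>)"
    using assms(1,2)
  proof (induction ks)
    case Nil
    then show ?case using assms(3) by auto
  next
    case (Cons k ks)
    then obtain \<theta> where "foldr G ks x \<in> V \<theta>" "T (foldr G ks x) = foldr G ks (T x)" by auto
    then show ?case using Cons.prems by auto
  qed
  then show ?thesis ..
qed

lemma foldr_0 [simp]: "foldr E ks 0 = 0" "foldr F ks 0 = 0"
  by (induction ks) auto

lemma foldr_F_scale: "foldr F ks (scale c x) = scale c (foldr F ks x)"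
  by (induction ks) auto

text \<open>The word is \<open>E i\<close> after \<open>E (i + 1)\<close> and so on down to
  \<open>E (q - 1)\<close> applied first; its roots telescope.\<close>

lemma E_chain_V:
  assumes "x \<in> V \<eta>" "1 \<le> i" "i \<le> q" "q \<le> n"
  shows "foldr E [i..<q] x \<in> V (\<eta> + eps i - eps q)"
  using assms(3,2)
proof (induction i rule: inc_induct)
  case base
  have "\<eta> + eps q - eps q = \<eta>" by simp
  then show ?case using assms by simp
next
  case (step i)
  have "\<eta> + eps (Suc i) - eps q + alpha i = \<eta> + eps i - eps q"
    by (auto simp: fun_eq_iff alpha_def)
  moreover have "foldr E [i..<q] x = E i (foldr E [Suc i..<q] x)"
    using step.hyps by (simp add: upt_conv_Cons)
  moreover have "E i (foldr E [Suc i..<q] x) \<in> V (\<eta> + eps (Suc i) - eps q + alpha i)"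
    using step.prems step.hyps assms by (intro E_V step.IH) auto
  ultimately show ?case by (simp only:)
qed

lemma F_chain_V:
  assumes "x \<in> V \<eta>" "1 \<le> i" "i \<le> q" "q \<le> n"
  shows "foldr F [i..<q] x \<in> V (\<eta> - eps i + eps q)"
  using assms(3,2)
proof (induction i rule: inc_induct)
  case base
  have "\<eta> - eps q + eps q = \<eta>" by simp
  then show ?case using assms by simp
next
  case (step i)
  have "\<eta> - eps (Suc i) + eps q - alpha i = \<eta> - eps i + eps q"
    by (auto simp: fun_eq_iff alpha_def)
  moreover have "foldr F [i..<q] x = F i (foldr F [Suc i..<q] x)"
    using step.hyps by (simp add: upt_conv_Cons)
  moreover have "F i (foldr F [Suc i..<q] x) \<in> V (\<eta> - eps (Suc i) + eps q - alpha i)"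
    using step.prems step.hyps assms by (intro F_V step.IH) auto
  ultimately show ?case by (simp only:)
qed

lemma E_F_chain:
  assumes "x \<in> V \<eta>" "j \<in> {1..<n}" "1 \<le> i" "q \<le> n" "j < i \<or> q \<le> j"
  shows "E j (foldr F [i..<q] x) = foldr F [i..<q] (E j x)"
proof (rule foldr_commute[OF _ _ assms(1)])
  fix k y \<theta> assume k: "k \<in> set [i..<q]" "y \<in> V \<theta>"
  then have "k \<in> {1..<n}" "j \<noteq> k" using assms by auto
  then show "E j (F k y) = F k (E j y)" "\<exists>\<theta>. F k y \<in> V \<theta>"
    using EF[OF assms(2) _ k(2), of k] F_V[OF _ k(2), of k] by auto
qed

lemma F_E_chain:
  assumes "x \<in> V \<eta>" "j \<in> {1..<n}" "1 \<le> i" "q \<le> n" "j < i \<or> q \<le> j"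
  shows "F j (foldr E [i..<q] x) = foldr E [i..<q] (F j x)"
proof (rule foldr_commute[OF _ _ assms(1)])
  fix k y \<theta> assume k: "k \<in> set [i..<q]" "y \<in> V \<theta>"
  then have "k \<in> {1..<n}" "j \<noteq> k" using assms by auto
  then show "F j (E k y) = E k (F j y)" "\<exists>\<theta>. E k y \<in> V \<theta>"
    using EF[OF _ assms(2) k(2), of k] E_V[OF _ k(2), of k] by auto
qed

lemma E_E_chain:
  assumes "x \<in> V \<eta>" "j \<in> {1..<n}" "1 \<le> i" "q \<le> n" "j + 1 < i \<or> q < j"
  shows "E j (foldr E [i..<q] x) = foldr E [i..<q] (E j x)"
proof (rule foldr_commute[OF _ _ assms(1)])
  fix k y \<theta> assume k: "k \<in> set [i..<q]" "y \<in> V \<theta>"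
  then have *: "k \<in> {1..<n}" "j + 1 < k \<or> k + 1 < j" using assms by auto
  then show "E j (E k y) = E k (E j y)" "\<exists>\<theta>. E k y \<in> V \<theta>"
    using EE[OF assms(2) _ _ k(2), of k] EE[OF _ assms(2) _ k(2), of k] E_V[OF _ k(2), of k] by auto
qed

lemma F_F_chain:
  assumes "x \<in> V \<eta>" "j \<in> {1..<n}" "1 \<le> i" "q \<le> n" "j + 1 < i \<or> q < j"
  shows "F j (foldr F [i..<q] x) = foldr F [i..<q] (F j x)"
proof (rule foldr_commute[OF _ _ assms(1)])
  fix k y \<theta> assume k: "k \<in> set [i..<q]" "y \<in> V \<theta>"
  then have *: "k \<in> {1..<n}" "j + 1 < k \<or> k + 1 < j" using assms by auto
  then show "F j (F k y) = F k (F j y)" "\<exists>\<theta>. F k y \<in> V \<theta>"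
    using FF[OF assms(2) _ _ k(2), of k] FF[OF _ assms(2) _ k(2), of k] F_V[OF _ k(2), of k] by auto
qed

section \<open>The correction vector of the rank induction\<close>

context
  fixes q :: nat and m :: 'v
  assumes q: "1 \<le> q" "q < n" and m_V: "m \<in> V 0"
    and E_m: "\<And>j. 1 \<le> j \<Longrightarrow> j < q \<Longrightarrow> E j m = 0"
    and F_m: "\<And>j. 1 \<le> j \<Longrightarrow> j < q \<Longrightarrow> F j m = 0"
begin

text \<open>For j < q, \<open>E j\<close> sends \<open>y (Suc j)\<close> to \<open>y j\<close>,
  \<open>F j\<close> sends \<open>y j\<close> to \<open>y (Suc j)\<close>, and both kill the other
  vectors among \<open>y 1\<close>, ..., \<open>y q\<close>. The lemmas on \<open>y\<close> below
  establish this pattern.\<close>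

definition y :: "nat \<Rightarrow> 'v" where "y i = foldr E [i..<Suc q] m"

definition W :: "nat \<Rightarrow> 'v" where "W i = foldr F [i..<Suc q] (y i)"

definition d :: "nat \<Rightarrow> 'k" where "d i = (- 1) ^ i * (inverse r ^ i - inverse s ^ i)"

text \<open>The coefficients \<open>d\<close> solve the recursion \<open>d_rec\<close>, which is exactly what \<open>E j D = 0\<close> amounts to for
  \<open>j < q\<close>.\<close>

definition D :: 'v where "D = (\<Sum>i=1..q. scale (d i) (W i))"

lemma y_Suc_q: "y (Suc q) = m"
  by (simp add: y_def)

lemma y_step: "i \<le> q \<Longrightarrow> y i = E i (y (Suc i))"
  by (simp add: y_def upt_conv_Cons del: upt_Suc)

lemma y_V: "1 \<le> i \<Longrightarrow> i \<le> Suc q \<Longrightarrow> y i \<in> V (eps i - eps (Suc q))"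
  using E_chain_V[OF m_V, of i "Suc q"] q by (simp add: y_def del: upt_Suc)

lemma F_y_less: "1 \<le> j \<Longrightarrow> j < q \<Longrightarrow> j < i \<Longrightarrow> F j (y i) = 0"
  unfolding y_def using q by (subst F_E_chain[OF m_V]) (auto simp: F_m simp del: upt_Suc)

lemma E_y_less: "1 \<le> j \<Longrightarrow> j < q \<Longrightarrow> j + 1 < i \<Longrightarrow> E j (y i) = 0"
  unfolding y_def using q by (subst E_E_chain[OF m_V]) (auto simp: E_m simp del: upt_Suc)

text \<open>\<open>F i\<close> kills \<open>y (Suc i)\<close>, so only the commutator of
  \<open>E i\<close> and \<open>F i\<close> survives. The weight entries 0 and 1 give it the value
  -1, and exchanging the factors turns the sign.\<close>

lemma F_y_eq:
  assumes i: "1 \<le> i" "i < q"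
  shows "F i (y i) = y (Suc i)"
proof -
  have "hval r s ((eps (Suc i) - eps (Suc q)) i) ((eps (Suc i) - eps (Suc q)) (i + 1)) = - 1"
    using i rs_ne by (simp add: hval_def eps_def divide_simps)
  then show ?thesis
    using EF[OF _ _ y_V[of "Suc i"], of i i] F_y_less[of i "Suc i"] i q y_step[of i]
    by (simp add: scale_minus_left)
qed

text \<open>\<open>F j\<close> passes the factors \<open>E i\<close> until it reaches
  \<open>y j\<close>, which it turns into \<open>y (Suc j)\<close>; the factor
  \<open>E (j - 1)\<close> in front kills that vector.\<close>

lemma F_y_greater:
  assumes "1 \<le> i" "i < j" "j < q"
  shows "F j (y i) = 0"
proof -
  have j: "i \<le> j - 1" "1 \<le> j" using assms by auto
  show ?thesis using j(1) assms(1)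
  proof (induction i rule: inc_induct)
    case base
    have "F j (y (j - 1)) = E (j - 1) (F j (y j))"
      using EF[OF _ _ y_V[of j], of "j - 1" j] y_step[of "j - 1"] base assms q by auto
    then show ?case using F_y_eq[of j] E_y_less[of "j - 1" "Suc j"] base assms by auto
  next
    case (step i)
    have "F j (y i) = E i (F j (y (Suc i)))"
      using EF[OF _ _ y_V[of "Suc i"], of i j] y_step[of i] step.prems step.hyps assms q by auto
    then show ?case using step by simp
  qed
qed

text \<open>\<open>E i\<close> acts twice on \<open>y (Suc i)\<close>, which is killed by
  \<open>F i\<close> and has weight entries 0 and 1, so its string has at most two members.\<close>

lemma E_y_eq: "1 \<le> i \<Longrightarrow> i < q \<Longrightarrow> E i (y i) = 0"
  using E_string[of i "y (Suc i)" "eps (Suc i) - eps (Suc q)" 1] y_V[of "Suc i"] q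
    F_y_less[of i "Suc i"] y_step[of i]
  by (simp add: eps_def)

lemma E_y_greater: "1 \<le> i \<Longrightarrow> i < j \<Longrightarrow> j < q \<Longrightarrow> E j (y i) = 0"
  using E_eq_0[of j "y i" "eps i - eps (Suc q)"] y_V[of i] q F_y_greater[of i j]
  by (simp add: eps_def)

lemma E_y_prev: "1 \<le> j \<Longrightarrow> j < q \<Longrightarrow> E j (y (Suc j)) = y j"
  using y_step[of j] by simp

text \<open>All contributions are multiples of one vector, which turns \<open>E j D = 0\<close> into
  a scalar recursion. For i = j + 1, \<open>E j\<close> reaches \<open>y i\<close>; for i \<le> j it
  is caught by \<open>F j\<close>, and the commutator contributes \<open>hval\<close> at the weight
  entries (1, -1) if i = j and (0, -1) if i < j.\<close>

lemma E_W:
  assumes j: "1 \<le> j" "j < q" and i: "1 \<le> i" "i \<le> q"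
  shows "E j (W i) = scale (if i = Suc j then 1 else if i = j then inverse r + inverse s
    else if Suc i = j then inverse r * inverse s else 0) (foldr F [Suc j..<Suc q] (y j))"
proof -
  have jn: "j \<in> {1..<n}" "Suc q \<le> n" using j q by auto
  consider "j + 1 < i" | "i = Suc j" | "i = j" | "i < j" by linarith
  then show ?thesis
  proof cases
    case 1
    then have "E j (W i) = foldr F [i..<Suc q] (E j (y i))"
      unfolding W_def using jn i by (intro E_F_chain[OF y_V]) auto
    then show ?thesis using E_y_less[of j i] j 1 by simp
  next
    case 2
    then have "E j (W i) = foldr F [i..<Suc q] (E j (y i))"
      unfolding W_def using jn i by (intro E_F_chain[OF y_V]) auto
    then show ?thesis using E_y_prev[of j] j 2 by simp
  next
    case 3
    let ?X = "foldr F [Suc j..<Suc q] (y j)"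
    have X: "?X \<in> V (eps j - eps (Suc q) - eps (Suc j) + eps (Suc q))"
      using jn j q by (intro F_chain_V y_V) auto
    have "E j ?X = foldr F [Suc j..<Suc q] (E j (y j))"
      using jn j by (intro E_F_chain[OF y_V]) auto
    then have EX: "E j ?X = 0" using E_y_eq[of j] j by simp
    have "hval r s ((eps j - eps (Suc q) - eps (Suc j) + eps (Suc q)) j)
        ((eps j - eps (Suc q) - eps (Suc j) + eps (Suc q)) (j + 1)) = inverse r + inverse s"
      using rs_ne r0 s0 j by (simp add: hval_def eps_def power_int_minus field_simps)
    moreover have "W i = F j ?X"
      using j 3 by (simp add: W_def upt_conv_Cons del: upt_Suc)
    ultimately show ?thesis using EF[OF jn(1) jn(1) X] EX 3 by simp
  next
    case 4
    let ?X = "foldr F [Suc j..<Suc q] (y i)"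
    have X: "?X \<in> V (eps i - eps (Suc q) - eps (Suc j) + eps (Suc q))"
      using jn i j q by (intro F_chain_V y_V) auto
    have FX: "F j ?X \<in> V (eps i - eps (Suc q) - eps (Suc j) + eps (Suc q) - alpha j)"
      by (rule F_V[OF jn(1) X])
    have "E j ?X = foldr F [Suc j..<Suc q] (E j (y i))"
      using jn j i by (intro E_F_chain[OF y_V]) auto
    then have EX: "E j ?X = 0" using E_y_greater[of i j] j 4 i by simp
    have "hval r s ((eps i - eps (Suc q) - eps (Suc j) + eps (Suc q)) j)
        ((eps i - eps (Suc q) - eps (Suc j) + eps (Suc q)) (j + 1)) = inverse r * inverse s"
      using rs_ne r0 s0 j 4 by (simp add: hval_def eps_def power_int_minus field_simps)
    then have EFX: "E j (F j ?X) = scale (inverse r * inverse s) ?X"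
      using EF[OF jn(1) jn(1) X] EX by simp
    have "[i..<Suc q] = [i..<j] @ [j..<Suc q]"
      using upt_add_eq_append[of i j "Suc q - j"] j 4 by (simp del: upt_Suc)
    then have "W i = foldr F [i..<j] (F j ?X)"
      using j by (simp add: W_def upt_conv_Cons del: upt_Suc)
    then have "E j (W i) = foldr F [i..<j] (scale (inverse r * inverse s) ?X)"
      using E_F_chain[OF FX jn(1) i(1), of j] jn EFX by simp
    also have "\<dots> = scale (inverse r * inverse s) (foldr F [i..<j] ?X)"
      by (rule foldr_F_scale)
    also have "[i..<j] = [i..<j-1] @ [j-1]"
      using 4 upt_Suc_append[of i "j-1"] by simp
    also have "foldr F ([i..<j-1] @ [j-1]) ?X = foldr F [i..<j-1] (F (j-1) ?X)" by simp
    \<comment> \<open>\<open>F (j - 1)\<close> commutes with the whole word from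
      \<open>F (Suc j)\<close> to \<open>F q\<close> and so acts directly on \<open>y i\<close>; the
      result is nonzero only if i = j - 1.\<close>
    also have "F (j-1) ?X = foldr F [Suc j..<Suc q] (F (j-1) (y i))"
      using jn j i 4 by (intro F_F_chain[OF y_V]) auto
    finally have *: "E j (W i) = scale (inverse r * inverse s)
      (foldr F [i..<j-1] (foldr F [Suc j..<Suc q] (F (j-1) (y i))))" .
    show ?thesis
    proof (cases "Suc i = j")
      case True
      then have "F (j-1) (y i) = y j" using F_y_eq[of i] i j by auto
      moreover have "[i..<j-1] = []" using True by simp
      ultimately show ?thesis using * True 4 by simp
    next
      case False
      then have "F (j-1) (y i) = 0" using F_y_greater[of i "j-1"] i j 4 by auto
      then show ?thesis using * False 4 by simp
    qed
  qed
qed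

text \<open>The characteristic polynomial has the roots \<open>- inverse r\<close> and
  \<open>- inverse s\<close>. The solution is normalised by \<open>d 0 = 0\<close>, which accounts
  for the absence of a term with \<open>W 0\<close>.\<close>

lemma d_rec: "1 \<le> j \<Longrightarrow> d (Suc j) + (inverse r + inverse s) * d j + inverse r * inverse s * d (j - 1) = 0"
  by (cases j) (simp_all add: d_def algebra_simps)

lemma E_D:
  assumes j: "1 \<le> j" "j < q"
  shows "E j D = 0"
proof -
  define c :: "nat \<Rightarrow> 'k" where "c i = (if i = Suc j then 1 else if i = j then inverse r + inverse s
    else if Suc i = j then inverse r * inverse s else 0)" for i
  let ?X = "foldr F [Suc j..<Suc q] (y j)"
  have lin: "E j (sum g A) = (\<Sum>i\<in>A. E j (g i))" for g and A :: "nat set"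
    by (rule module_hom.sum[OF E_hom])
  have "E j D = (\<Sum>i=1..q. scale (d i * c i) ?X)"
    unfolding D_def lin by (rule sum.cong) (simp_all add: E_W[OF j] c_def)
  also have "\<dots> = scale (\<Sum>i=1..q. d i * c i) ?X"
    by (simp add: scale_sum_left)
  \<comment> \<open>For j = 1 the index j - 1 = 0 lies outside the range; it may be added because
    \<open>d 0 = 0\<close>.\<close>
  also have "(\<Sum>i=1..q. d i * c i) = (\<Sum>i\<in>{j - 1, j, Suc j}. d i * c i)"
  proof (rule sum.mono_neutral_cong)
    fix i assume "i \<in> {j - 1, j, Suc j} - {1..q}"
    then have "i = 0" using j by auto
    then show "d i * c i = 0" by (simp add: d_def)
  qed (auto simp: c_def)
  also have "\<dots> = 0"
    using j d_rec[of j] by (cases j) (simp_all add: c_def algebra_simps)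
  finally show ?thesis by simp
qed

lemma W_V:
  assumes "1 \<le> i" "i \<le> q"
  shows "W i \<in> V 0"
proof -
  have "W i \<in> V (eps i - eps (Suc q) - eps i + eps (Suc q))"
    unfolding W_def using assms q by (intro F_chain_V y_V) auto
  then show ?thesis by (simp add: zero_fun_def)
qed

lemma D_V: "D \<in> V 0"
  unfolding D_def using W_V by (auto intro!: subspace_sum subspace_scale subspace_V)

lemma F_D: "1 \<le> j \<Longrightarrow> j < q \<Longrightarrow> F j D = 0"
  using F_eq_0[OF _ D_V, of j] E_D[of j] q by simp

lemma W_L:
  assumes "1 \<le> i" "i \<le> q"
  shows "W i \<in> L"
proof -
  have "foldr F [Suc i..<Suc q] (y i) \<in> V (eps i - eps (Suc q) - eps (Suc i) + eps (Suc q))"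
    using assms q by (intro F_chain_V y_V) auto
  moreover have "W i = F i (foldr F [Suc i..<Suc q] (y i))"
    using assms by (simp add: W_def upt_conv_Cons del: upt_Suc)
  ultimately show ?thesis using F_L[of i] assms q by auto
qed

lemma D_L: "D \<in> L"
  unfolding D_def using W_L by (auto intro!: subspace_sum subspace_scale subspace_L)

text \<open>The Serre relation reduces on \<open>m\<close> to a two-term recursion, because \<open>E (q - 1)\<close> kills \<open>m\<close>.\<close>

lemma Serre_string:
  assumes q1: "2 \<le> q"
  shows "scale (r ^ Suc k - s ^ Suc k) (E q (E (q-1) ((E q ^^ k) m)))
    = scale (r ^ k - s ^ k) (E (q-1) ((E q ^^ Suc k) m))"
proof (induction k)
  case 0
  then show ?case using E_m[of "q-1"] q1 by simp
next
  case (Suc k)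
  let ?x = "(E q ^^ k) m"
  let ?Y = "E q (E (q-1) (E q ?x))" and ?Z = "E (q-1) (E q (E q ?x))"
  have V: "?x \<in> V (\<lambda>i. 0 i + int k * alpha q i)"
    using q by (intro E_pow_V m_V) auto
  have S: "?Z = scale (r + s) ?Y - scale (r * s) (E q (E q (E (q-1) ?x)))"
    using Serre[OF _ _ V, of "q-1"] q q1 by (simp add: algebra_simps eq_neg_iff_add_eq_0)
  have "scale (r ^ Suc k - s ^ Suc k) (E q (E q (E (q-1) ?x)))
     = E q (scale (r ^ Suc k - s ^ Suc k) (E q (E (q-1) ?x)))" by simp
  also have "\<dots> = scale (r ^ k - s ^ k) ?Y"
    unfolding Suc.IH by simp
  finally have R: "scale (r ^ Suc k - s ^ Suc k) (E q (E q (E (q-1) ?x))) = scale (r ^ k - s ^ k) ?Y" .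
  have "scale (r ^ Suc k - s ^ Suc k) ?Z = scale ((r ^ Suc k - s ^ Suc k) * (r + s)) ?Y
      - scale (r * s) (scale (r ^ Suc k - s ^ Suc k) (E q (E q (E (q-1) ?x))))"
    unfolding S by (simp add: scale_right_diff_distrib mult.commute del: power_Suc)
  also have "\<dots> = scale ((r ^ Suc k - s ^ Suc k) * (r + s) - r * s * (r ^ k - s ^ k)) ?Y"
    unfolding R
    by (simp only: scale_scale
        scale_left_diff_distrib[of "(r ^ Suc k - s ^ Suc k) * (r + s)" "r * s * (r ^ k - s ^ k)"])
  also have "(r ^ Suc k - s ^ Suc k) * (r + s) - r * s * (r ^ k - s ^ k) = r ^ Suc (Suc k) - s ^ Suc (Suc k)"
    by (simp add: algebra_simps)
  finally show ?case by simp
qed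

text \<open>\<open>Serre_string\<close> brings \<open>E (q - 1)\<close> to the front at the cost of
  a quotient of quantum integers with nonzero denominator. Once \<open>E q ^^ Suc k\<close> kills
  \<open>m\<close>, it follows that \<open>E q ^^ k\<close> kills \<open>y (q - 1)\<close>.\<close>

lemma E_pow_y_prev:
  assumes q1: "2 \<le> q"
  shows "\<exists>c. (E q ^^ k) (y (q-1)) = scale c (E (q-1) ((E q ^^ Suc k) m))"
proof (induction k)
  case 0
  have "y (q-1) = E (q-1) (E q m)"
    using y_step[of "q-1"] y_step[of q] y_Suc_q q1 by simp
  then show ?case by (intro exI[of _ 1]) simp
next
  case (Suc k)
  then obtain c where c: "(E q ^^ k) (y (q-1)) = scale c (E (q-1) ((E q ^^ Suc k) m))" by blast
  have nz: "r ^ Suc (Suc k) - s ^ Suc (Suc k) \<noteq> 0" using rs_pow[of "Suc (Suc k)"] by simp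
  have "E q (E (q-1) ((E q ^^ Suc k) m))
    = scale (inverse (r ^ Suc (Suc k) - s ^ Suc (Suc k)) * (r ^ Suc k - s ^ Suc k)) (E (q-1) ((E q ^^ Suc (Suc k)) m))"
    using arg_cong[OF Serre_string[OF q1, of "Suc k"], of "scale (inverse (r ^ Suc (Suc k) - s ^ Suc (Suc k)))"] nz
    by (simp del: power_Suc funpow.simps)
  then show ?case using c by auto
qed

lemma powi_neg: "x powi (- 1 - int l) = inverse (x :: 'k) ^ Suc l"
proof -
  have "- 1 - int l = - int (Suc l)" by simp
  then show ?thesis by (simp only: power_int_minus power_int_of_nat power_inverse)
qed

section \<open>Evaluation of \<open>E q ^^ k\<close> on the correction vector\<close>

context
  fixes k :: nat
  assumes k: "0 < k" and E_Suc_k: "(E q ^^ Suc k) m = 0"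
begin

text \<open>For i = q - 1 this is \<open>E_pow_y_prev\<close>. A smaller i adds only factors
  \<open>E i\<close> with i + 1 < q, and these commute with \<open>E q\<close>.\<close>

lemma E_pow_y:
  assumes i: "1 \<le> i" "i < q"
  shows "(E q ^^ k) (y i) = 0"
proof -
  have "i \<le> q - 1" using i by simp
  then show ?thesis using i(1)
  proof (induction i rule: inc_induct)
    case base
    then show ?case using E_pow_y_prev[of k] E_Suc_k q i by (auto simp del: funpow.simps)
  next
    case (step i)
    have "(E q ^^ l) (E i (y (Suc i))) = E i ((E q ^^ l) (y (Suc i)))" for l
    proof (induction l)
      case 0
      then show ?case by simp
    next
      case (Suc l)
      have "(E q ^^ l) (y (Suc i)) \<in> V (\<lambda>j. (eps (Suc i) - eps (Suc q)) j + int l * alpha q j)"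
        using step q by (intro E_pow_V y_V) auto
      from EE[OF _ _ _ this, of i q] show ?case using Suc step q by simp
    qed
    then show ?case using step y_step[of i] by simp
  qed
qed

lemma E_pow_F_chain:
  assumes "1 \<le> i" "x \<in> V \<eta>"
  shows "(E q ^^ l) (foldr F [i..<q] x) = foldr F [i..<q] ((E q ^^ l) x)"
proof (induction l)
  case 0
  then show ?case by simp
next
  case (Suc l)
  have "(E q ^^ l) x \<in> V (\<lambda>j. \<eta> j + int l * alpha q j)"
    using assms q by (intro E_pow_V) auto
  from E_F_chain[OF this, of q i q] show ?case using Suc assms q by simp
qed

text \<open>The total of the contributions of \<open>W (q - 1)\<close> and \<open>W q\<close>,
  factored so that each factor is visibly nonzero. The exponent q + k arises because the
  coefficients \<open>d\<close> and the string scalars combine.\<close>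

definition \<delta> :: 'k where
  "\<delta> = (- 1) ^ q * (r ^ k - s ^ k) * (inverse s - inverse r) * (inverse r ^ (q + k) - inverse s ^ (q + k)) * (r * s) / (r - s)^2"

lemma \<delta>_nz: "\<delta> \<noteq> 0"
  using rs_pow[of k] rs_pow[of "q + k"] k r0 s0 rs_ne
  by (simp add: \<delta>_def power_inverse)

text \<open>Here \<open>W q\<close> is \<open>F q (E q m)\<close>. In the string formula the term
  with \<open>F q\<close> in front contains \<open>(E q ^^ Suc k) m\<close> and vanishes.\<close>

lemma E_W_q: "(E q ^^ k) (W q) = scale ((r ^ k - s ^ k) * (r * inverse s ^ k - inverse r ^ k * s) / (r - s)^2) ((E q ^^ k) m)"
proof -
  obtain l where l: "k = Suc l" using k gr0_implies_Suc by blast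
  have q': "q \<in> {1..<n}" using q by simp
  have EV: "E q m \<in> V (0 + alpha q)" using E_V[OF q' m_V] .
  have W: "W q = F q (E q m)" using y_step[of q] y_Suc_q q by (simp add: W_def)
  have 1: "(E q ^^ Suc l) (E q m) = 0" using E_Suc_k l by (simp add: funpow_swap1)
  have 2: "(E q ^^ l) (E q m) = (E q ^^ k) m" using l by (simp add: funpow_swap1)
  have "r powi ((0 + alpha q) q) * s powi ((0 + alpha q) (q + 1) - int l)
      - r powi ((0 + alpha q) (q + 1) - int l) * s powi ((0 + alpha q) q) = r * inverse s ^ k - inverse r ^ k * s"
    by (simp add: alpha_def eps_def powi_neg l)
  then show ?thesis using E_pow_F[OF q' EV, of l] 1 2 W l by (simp del: funpow.simps power_Suc)
qed

text \<open>\<open>E q\<close> passes \<open>F (q - 1)\<close>, and the string formula trades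
  \<open>F q\<close> for one power of \<open>E q\<close>. The remaining
  \<open>F (q - 1) (y (q - 1))\<close> is \<open>E q m\<close>, which restores the lost
  power.\<close>

lemma E_W_prev:
  assumes q1: "2 \<le> q"
  shows "(E q ^^ k) (W (q-1)) = scale ((r ^ k - s ^ k) * (inverse s ^ k - inverse r ^ k) / (r - s)^2) ((E q ^^ k) m)"
    (is "_ = scale ?c _")
proof -
  obtain l where l: "k = Suc l" using k gr0_implies_Suc by blast
  have q': "q \<in> {1..<n}" using q by simp
  have yV: "y (q-1) \<in> V (eps (q-1) - eps (Suc q))" using y_V[of "q-1"] q1 by simp
  have FV: "F q (y (q-1)) \<in> V (eps (q-1) - eps (Suc q) - alpha q)" using F_V[OF q' yV] .
  have "[q-1..<Suc q] = [q-1..<q] @ [q]" using q1 by simp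
  then have "W (q-1) = foldr F [q-1..<q] (F q (y (q-1)))" by (simp add: W_def del: upt_Suc)
  then have W: "(E q ^^ k) (W (q-1)) = foldr F [q-1..<q] ((E q ^^ k) (F q (y (q-1))))"
    using E_pow_F_chain[OF _ FV] q1 by simp
  have "r powi ((eps (q-1) - eps (Suc q)) q) * s powi ((eps (q-1) - eps (Suc q)) (q + 1) - int l)
      - r powi ((eps (q-1) - eps (Suc q)) (q + 1) - int l) * s powi ((eps (q-1) - eps (Suc q)) q)
      = inverse s ^ k - inverse r ^ k"
  proof -
    have "q \<noteq> q - 1" "Suc q \<noteq> q - 1" using q1 by auto
    then show ?thesis by (simp add: eps_def powi_neg l)
  qed
  then have "(E q ^^ k) (F q (y (q-1))) = scale ?c ((E q ^^ l) (y (q-1)))"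
    using E_pow_F[OF q' yV, of l] E_pow_y[of "q-1"] q1 l by (simp del: funpow.simps power_Suc)
  then have "(E q ^^ k) (W (q-1)) = scale ?c (foldr F [q-1..<q] ((E q ^^ l) (y (q-1))))"
    using W by (simp add: foldr_F_scale)
  also have "foldr F [q-1..<q] ((E q ^^ l) (y (q-1))) = (E q ^^ l) (foldr F [q-1..<q] (y (q-1)))"
    using E_pow_F_chain[OF _ yV] q1 by simp
  also have "foldr F [q-1..<q] (y (q-1)) = F (q-1) (y (q-1))" using q1 by (simp add: upt_conv_Cons)
  also have "\<dots> = E q m" using F_y_eq[of "q-1"] q1 y_step[of q] y_Suc_q by simp
  also have "(E q ^^ l) (E q m) = (E q ^^ k) m" using l by (simp add: funpow_swap1)
  finally show ?thesis .
qed

text \<open>As for \<open>W (q - 1)\<close>, but after \<open>F q\<close> is removed the innermost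
  factor is \<open>F (q - 1)\<close>, which kills \<open>y i\<close>.\<close>

lemma E_W_rest:
  assumes i: "1 \<le> i" "i + 1 < q"
  shows "(E q ^^ k) (W i) = 0"
proof -
  obtain l where l: "k = Suc l" using k gr0_implies_Suc by blast
  have q': "q \<in> {1..<n}" using q by simp
  have yV: "y i \<in> V (eps i - eps (Suc q))" using y_V[of i] i by simp
  have FV: "F q (y i) \<in> V (eps i - eps (Suc q) - alpha q)" using F_V[OF q' yV] .
  have "[i..<Suc q] = [i..<q] @ [q]" using i by simp
  then have "W i = foldr F [i..<q] (F q (y i))" by (simp add: W_def del: upt_Suc)
  then have W: "(E q ^^ k) (W i) = foldr F [i..<q] ((E q ^^ k) (F q (y i)))"
    using E_pow_F_chain[OF i(1) FV] by simp
  obtain c where "(E q ^^ k) (F q (y i)) = scale c ((E q ^^ l) (y i))"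
    using E_pow_F[OF q' yV, of l] E_pow_y[of i] i l by (auto simp del: funpow.simps power_Suc)
  then have "(E q ^^ k) (W i) = scale c (foldr F [i..<q] ((E q ^^ l) (y i)))"
    using W by (simp add: foldr_F_scale)
  also have "foldr F [i..<q] ((E q ^^ l) (y i)) = (E q ^^ l) (foldr F [i..<q] (y i))"
    using E_pow_F_chain[OF i(1) yV] by simp
  also have "[i..<q] = [i..<q-1] @ [q-1]"
    using i upt_Suc_append[of i "q-1"] by simp
  also have "foldr F ([i..<q-1] @ [q-1]) (y i) = 0"
    using F_y_greater[of i "q-1"] i by simp
  finally show ?thesis by (simp add: module_hom.zero[OF E_pow_hom])
qed

lemma E_pow_D: "(E q ^^ k) D = scale \<delta> ((E q ^^ k) m)"
proof -
  have lin: "(E q ^^ k) (sum g A) = (\<Sum>i\<in>A. (E q ^^ k) (g i))" for g and A :: "nat set"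
    by (rule module_hom.sum[OF E_pow_hom])
  define G where "G i = scale (d i) ((E q ^^ k) (W i))" for i
  \<comment> \<open>For q = 1 there is no \<open>W (q - 1)\<close> in \<open>D\<close>; as
    \<open>d 0 = 0\<close>, both sides vanish and the formula extends to this case.\<close>
  have G_prev: "G (q-1) = scale (d (q-1) * ((r ^ k - s ^ k) * (inverse s ^ k - inverse r ^ k) / (r - s)^2)) ((E q ^^ k) m)"
  proof (cases "2 \<le> q")
    case True
    then show ?thesis by (simp only: G_def E_W_prev[OF True] scale_scale)
  next
    case False
    then have "q - 1 = 0" by simp
    then show ?thesis by (simp add: G_def d_def)
  qed
  have "(E q ^^ k) D = (\<Sum>i=1..q. G i)"
    unfolding D_def lin G_def by (simp add: module_hom.scale[OF E_pow_hom])
  also have "\<dots> = (\<Sum>i\<in>{q-1, q}. G i)"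
  proof (rule sum.mono_neutral_cong)
    fix i assume "i \<in> {q-1, q} - {1..q}"
    then have "i = 0" using q by auto
    then show "G i = 0" by (simp add: G_def d_def)
  next
    fix i assume "i \<in> {1..q} - {q-1, q}"
    then have "1 \<le> i" "i + 1 < q" by auto
    then show "G i = 0" by (simp add: G_def E_W_rest)
  qed auto
  also have "\<dots> = scale ((d (q-1) * ((r ^ k - s ^ k) * (inverse s ^ k - inverse r ^ k) / (r - s)^2))
     + d q * ((r ^ k - s ^ k) * (r * inverse s ^ k - inverse r ^ k * s) / (r - s)^2)) ((E q ^^ k) m)"
    using q G_prev by (simp add: G_def E_W_q scale_left_distrib)
  also have "d (q-1) * ((r ^ k - s ^ k) * (inverse s ^ k - inverse r ^ k) / (r - s)^2)
     + d q * ((r ^ k - s ^ k) * (r * inverse s ^ k - inverse r ^ k * s) / (r - s)^2)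
     = (d (q-1) * (inverse s ^ k - inverse r ^ k) + d q * (r * inverse s ^ k - inverse r ^ k * s))
        * (r ^ k - s ^ k) / (r - s)^2"
    by (simp only: times_divide_eq_right add_divide_distrib[symmetric]) (simp add: algebra_simps)
  also have "d (q-1) * (inverse s ^ k - inverse r ^ k) + d q * (r * inverse s ^ k - inverse r ^ k * s)
    = (- 1) ^ q * (inverse s - inverse r) * (inverse r ^ (q + k) - inverse s ^ (q + k)) * (r * s)"
  proof -
    obtain p where p: "q = Suc p" using q by (cases q) auto
    define u v where "u = inverse r" and "v = inverse s"
    \<comment> \<open>\<open>A, B\<close> stand for the p-th and \<open>P, Q\<close> for the k-th
      powers of \<open>u, v\<close>. With these as free variables, only \<open>u * r = 1\<close> and
      \<open>v * s = 1\<close> are used.\<close>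
    have "w * (A - B) * (Q - P) + - 1 * w * (u * A - v * B) * (r * Q - P * s)
        = - 1 * w * (v - u) * (u * A * P - v * B * Q) * (r * s)" for w A B P Q
      using r0 s0 by (simp add: u_def v_def field_simps)
    then show ?thesis
      unfolding d_def p u_def[symmetric] v_def[symmetric] power_add power_Suc diff_Suc_1 .
  qed
  finally show ?thesis by (simp add: \<delta>_def mult_ac)
qed

end

end

text \<open>The descent stops at K = 1: K = 0 would put \<open>m\<close> into \<open>L\<close>. Then
  \<open>E (Suc p)\<close> kills \<open>m\<close>, and so does \<open>F (Suc p)\<close> because
  \<open>m\<close> has weight 0. The bound \<open>max 1 n\<close> keeps p = 0 available for n =
  0.\<close>

lemma exists_invariant_upto:
  assumes "\<exists>m\<in>V 0. m \<notin> L" "p < max 1 n"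
  shows "\<exists>m\<in>V 0. m \<notin> L \<and> (\<forall>j. 1 \<le> j \<and> j \<le> p \<longrightarrow> E j m = 0 \<and> F j m = 0)"
  using assms(2)
proof (induction p)
  case 0
  then show ?case using assms(1) by (meson le_trans not_one_le_zero)
next
  case (Suc p)
  define Z where "Z = {m \<in> V 0. m \<notin> L \<and> (\<forall>j. 1 \<le> j \<and> j \<le> p \<longrightarrow> E j m = 0 \<and> F j m = 0)}"
  have q: "1 \<le> Suc p" "Suc p < n" "Suc p \<in> {1..<n}" using Suc.prems by auto
  have "p < max 1 n" using Suc.prems by simp
  from Suc.IH[OF this] obtain m\<^sub>0 where m0: "m\<^sub>0 \<in> Z" unfolding Z_def by blast
  then obtain k\<^sub>0 where k0: "(E (Suc p) ^^ k\<^sub>0) m\<^sub>0 = 0" using E_nil[OF q(3)] unfolding Z_def by blast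
  define P where "P k \<longleftrightarrow> (\<exists>m\<in>Z. (E (Suc p) ^^ k) m = 0)" for k
  define K where "K = (LEAST k. P k)"
  have "P k\<^sub>0" using m0 k0 by (auto simp: P_def)
  then have "P K" unfolding K_def by (rule LeastI)
  then obtain m where m: "m \<in> Z" and mK: "(E (Suc p) ^^ K) m = 0" by (auto simp: P_def)
  have mV: "m \<in> V 0" and mE: "\<And>j. 1 \<le> j \<Longrightarrow> j < Suc p \<Longrightarrow> E j m = 0"
    and mF: "\<And>j. 1 \<le> j \<Longrightarrow> j < Suc p \<Longrightarrow> F j m = 0" and mL: "m \<notin> L"
    using m by (auto simp: Z_def)
  note ctx = q(1,2) mV mE mF
  have "K \<noteq> 0" using mK mL subspace_0[OF subspace_L] by (metis funpow_0)
  then obtain k where k: "K = Suc k" by (cases K) auto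
  have "k = 0"
  proof (rule ccontr)
    assume k0: "k \<noteq> 0"
    let ?D = "D (Suc p) m" and ?\<delta> = "\<delta> (Suc p) k"
    have ED: "(E (Suc p) ^^ k) ?D = scale ?\<delta> ((E (Suc p) ^^ k) m)"
      using k0 mK by (intro E_pow_D ctx) (auto simp: k)
    have nz: "?\<delta> \<noteq> 0"
      using k0 mK by (intro \<delta>_nz[where m = m] ctx) (auto simp: k)
    define m' where "m' = m - scale (inverse ?\<delta>) ?D"
    have "m' \<in> V 0" unfolding m'_def
      by (intro subspace_diff subspace_scale subspace_V mV D_V ctx)
    moreover have "m' \<notin> L"
    proof
      assume "m' \<in> L"
      moreover have "scale (inverse ?\<delta>) ?D \<in> L"
        by (intro subspace_scale subspace_L D_L ctx)
      ultimately have "m' + scale (inverse ?\<delta>) ?D \<in> L" by (rule subspace_add[OF subspace_L])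
      then show False using mL by (simp add: m'_def)
    qed
    moreover have "E j m' = 0" "F j m' = 0" if "1 \<le> j" "j \<le> p" for j
      using that E_D[OF ctx] F_D[OF ctx] mE mF by (simp_all add: m'_def)
    ultimately have "m' \<in> Z" by (simp add: Z_def)
    moreover have "(E (Suc p) ^^ k) m' = 0"
      unfolding m'_def module_hom.diff[OF E_pow_hom] module_hom.scale[OF E_pow_hom] ED
      using nz by simp
    ultimately have "P k" by (auto simp: P_def)
    then have "K \<le> k" unfolding K_def by (rule Least_le)
    then show False using k by simp
  qed
  then have "E (Suc p) m = 0" using mK k by simp
  moreover from this have "F (Suc p) m = 0" using F_eq_0[OF q(3) mV] by simp
  ultimately have "E j m = 0 \<and> F j m = 0" if "1 \<le> j \<and> j \<le> Suc p" for j
    using that mE mF by (cases "j = Suc p") auto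
  then show ?case using mV mL by blast
qed

theorem exists_invariant:
  assumes "\<exists>m\<in>V 0. m \<notin> L"
  shows "\<exists>m\<in>V 0. m \<notin> L \<and> (\<forall>j\<in>{1..<n}. E j m = 0 \<and> F j m = 0)"
  using exists_invariant_upto[OF assms, of "n - 1"] by fastforce

end

section \<open>Weyl's trick\<close>

text \<open>In the expansion, terms with all three operators on one side of \<open>p\<close> vanish
  by the Serre relation, and the twists are such that the mixed terms cancel. The parameter
  \<open>q\<close> serves to write every twist without inverses.\<close>

lemma (in vector_space) Serre_adjoint:
  assumes e1: "module_hom scale scale e1" and e2: "module_hom scale scale e2" and p: "module_hom scale scale p"
    and S: "\<And>x. e1 (e2 (e2 x)) - scale (r + s) (e2 (e1 (e2 x))) + scale (r * s) (e2 (e2 (e1 x))) = 0"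
  defines "T \<equiv> \<lambda>e k (p :: 'b \<Rightarrow> 'b) x. e (p x) - scale k (p (e x))"
  shows "T e1 (k1 * s * s) (T e2 (r * r * q) (T e2 (r * s * q) p)) x
     - scale (r + s) (T e2 (r * q) (T e1 (k1 * s) (T e2 (r * s * q) p)) x)
     + scale (r * s) (T e2 (r * q) (T e2 (s * q) (T e1 k1 p)) x) = 0"
proof -
  note [simp] = module_hom.add[OF e1] module_hom.diff[OF e1] module_hom.scale[OF e1]
    module_hom.add[OF e2] module_hom.diff[OF e2] module_hom.scale[OF e2]
    module_hom.add[OF p] module_hom.diff[OF p] module_hom.scale[OF p]
  have S': "e1 (e2 (e2 x)) = scale (r + s) (e2 (e1 (e2 x))) - scale (r * s) (e2 (e2 (e1 x)))" for x
    using S[of x] by (simp add: algebra_simps eq_neg_iff_add_eq_0)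
  show ?thesis
    unfolding T_def by (simp add: S' algebra_simps)
qed

section \<open>Eigenvector arguments in finite dimension\<close>

lemma (in vector_space) sum_eigenvectors_eq_0:
  fixes K :: nat
  assumes g: "module_hom scale scale g"
    and eig: "\<And>i. i < K \<Longrightarrow> g (v i) = scale (c i) (v i)" and nz: "\<And>i. i < K \<Longrightarrow> v i \<noteq> 0"
    and inj: "inj_on c {..<K}"
    and sum: "(\<Sum>i<K. scale (a i) (v i)) = 0"
  shows "\<forall>i<K. a i = 0"
  using assms(2-)
proof (induction K arbitrary: a)
  case 0
  then show ?case by simp
next
  case (Suc K)
  let ?v = "\<lambda>i. scale (a i) (v i)"
  have "0 = g (\<Sum>i<Suc K. ?v i) - scale (c K) (\<Sum>i<Suc K. ?v i)"
    unfolding Suc.prems(4) by (simp add: module_hom.zero[OF g])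
  also have "\<dots> = (\<Sum>i<Suc K. scale (a i * (c i - c K)) (v i))"
    unfolding module_hom.sum[OF g] scale_sum_right sum_subtractf[symmetric]
    by (rule sum.cong) (auto simp: module_hom.scale[OF g] Suc.prems(1) algebra_simps)
  also have "\<dots> = (\<Sum>i<K. scale (a i * (c i - c K)) (v i))" by simp
  finally have "\<forall>i<K. a i * (c i - c K) = 0"
    using Suc.prems by (intro Suc.IH) (auto simp: inj_on_def)
  moreover have "c i \<noteq> c K" if "i < K" for i
    using Suc.prems(3) that by (auto simp: inj_on_def)
  ultimately have "\<forall>i<K. a i = 0" by auto
  moreover from this have "a K = 0"
    using Suc.prems(2)[of K] Suc.prems(4) by simp
  ultimately show ?case by (auto simp: less_Suc_eq)
qed

lemma (in vector_space) independent_eigenvectors: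
  fixes K :: nat
  assumes g: "module_hom scale scale g"
    and eig: "\<And>i. i < K \<Longrightarrow> g (v i) = scale (c i) (v i)" and nz: "\<And>i. i < K \<Longrightarrow> v i \<noteq> 0"
    and inj: "inj_on c {..<K}"
  shows "inj_on v {..<K} \<and> independent (v ` {..<K})"
proof
  show v: "inj_on v {..<K}"
  proof (rule inj_onI)
    fix i j assume ij: "i \<in> {..<K}" "j \<in> {..<K}" "v i = v j"
    then have "scale (c i) (v i) = scale (c j) (v i)" using eig[of i] eig[of j] by (metis lessThan_iff)
    then have "c i = c j" using nz[of i] ij by simp
    then show "i = j" using inj ij by (auto simp: inj_on_def)
  qed
  show "independent (v ` {..<K})"
    unfolding independent_explicit_finite_subsets
  proof (intro allI impI ballI)
    fix A u w
    assume A: "A \<subseteq> v ` {..<K}" "finite A" and s0: "(\<Sum>w\<in>A. scale (u w) w) = 0" and w: "w \<in> A"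
    define a where "a i = (if v i \<in> A then u (v i) else 0)" for i
    have "(\<Sum>i<K. scale (a i) (v i)) = (\<Sum>w\<in>v ` {..<K}. scale (if w \<in> A then u w else 0) w)"
      by (simp add: sum.reindex[OF v] a_def)
    also have "\<dots> = (\<Sum>w\<in>A. scale (u w) w)"
      using A by (intro sum.mono_neutral_cong_right) auto
    finally have "\<forall>i<K. a i = 0"
      using s0 by (intro sum_eigenvectors_eq_0[OF g eig nz inj]) auto
    moreover obtain i where "i < K" "w = v i" using A w by auto
    ultimately show "u w = 0" using w by (auto simp: a_def)
  qed
qed

text \<open>Take \<open>Q\<close> of largest dimension among the stable subspaces that meet
  \<open>N\<close> in 0. If \<open>N + Q\<close> were proper, it would miss a common eigenvector,
  since these span; adjoining that vector to \<open>Q\<close> would contradict maximality.\<close>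

lemma (in vector_space) stable_complement:
  assumes fin: "finite B" "span B = UNIV"
    and N: "subspace N" "\<And>g x. g \<in> \<T> \<Longrightarrow> x \<in> N \<Longrightarrow> g x \<in> N"
    and hom: "\<And>g. g \<in> \<T> \<Longrightarrow> module_hom scale scale g"
    and eig: "span {x. \<forall>g\<in>\<T>. \<exists>c. g x = scale c x} = UNIV"
  shows "\<exists>Q. subspace Q \<and> (\<forall>g\<in>\<T>. \<forall>x\<in>Q. g x \<in> Q) \<and> N \<inter> Q = {0} \<and> (\<forall>x. \<exists>p\<in>N. x - p \<in> Q)"
proof -
  define P where "P Q \<longleftrightarrow> subspace Q \<and> (\<forall>g\<in>\<T>. \<forall>x\<in>Q. g x \<in> Q) \<and> N \<inter> Q = {0}" for Q
  have P0: "P {0}"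
    using subspace_0[OF N(1)] by (auto simp: P_def subspace_single_0 module_hom.zero[OF hom])
  have "dim Q < Suc (card B)" for Q
    using dim_le_card[of Q B] fin by (simp add: less_Suc_eq_le)
  then have "\<exists>Q. P Q \<and> (\<forall>Q'. P Q' \<longrightarrow> dim Q' \<le> dim Q)"
    using ex_has_greatest_nat[where P = P and k = "{0}" and f = dim and b = "Suc (card B)"] P0 by blast
  then obtain Q where Q: "P Q" and max: "\<And>Q'. P Q' \<Longrightarrow> dim Q' \<le> dim Q" by blast
  define S where "S = {p + q |p q. p \<in> N \<and> q \<in> Q}"
  have subQ: "subspace Q" using Q by (simp add: P_def)
  have subS: "subspace S" unfolding S_def by (rule subspace_sums[OF N(1) subQ])
  have "x \<in> S" if x: "\<forall>g\<in>\<T>. \<exists>c. g x = scale c x" for x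
  proof (rule ccontr)
    assume xS: "x \<notin> S"
    have xQ: "x \<notin> Q"
    proof
      assume "x \<in> Q"
      then have "0 + x \<in> S" unfolding S_def using subspace_0[OF N(1)] by blast
      then show False using xS by simp
    qed
    define Q' where "Q' = span (insert x Q)"
    have Q': "y \<in> Q' \<longleftrightarrow> (\<exists>c. y - scale c x \<in> Q)" for y
      unfolding Q'_def span_insert using subQ by (simp add: span_eq_iff[THEN iffD2])
    have "P Q'"
      unfolding P_def
    proof (intro conjI ballI)
      show "subspace Q'" by (simp add: Q'_def)
      fix g y assume g: "g \<in> \<T>" and "y \<in> Q'"
      then obtain c where c: "y - scale c x \<in> Q" using Q' by blast
      obtain d where d: "g x = scale d x" using x g by blast
      have "g (y - scale c x) \<in> Q" using c Q g by (simp add: P_def)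
      then have "g y - scale (c * d) x \<in> Q"
        by (simp add: module_hom.diff[OF hom[OF g]] module_hom.scale[OF hom[OF g]] d)
      then show "g y \<in> Q'" using Q' by blast
    next
      have "y = 0" if yN: "y \<in> N" and yQ: "y \<in> Q'" for y
      proof -
        obtain c where c: "y - scale c x \<in> Q" using yQ unfolding Q' by blast
        show ?thesis
        proof (cases "c = 0")
          case True
          then show ?thesis using c yN Q by (auto simp: P_def)
        next
          case False
          \<comment> \<open>\<open>y\<close> lies in \<open>N\<close> and
            \<open>y - scale c x\<close> in \<open>Q\<close>, so for nonzero \<open>c\<close> the
            vector \<open>x\<close> can be solved for inside \<open>N + Q\<close>.\<close>
          have "scale (inverse c) y + scale (- inverse c) (y - scale c x) \<in> S"
            unfolding S_def using subspace_scale[OF N(1) yN] subspace_scale[OF subQ c] by blast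
          also have "scale (inverse c) y + scale (- inverse c) (y - scale c x) = x"
            using False by (simp add: scale_right_diff_distrib)
          finally show ?thesis using xS by simp
        qed
      qed
      moreover have "0 \<in> N" "0 \<in> Q'" using subspace_0[OF N(1)] by (auto simp: Q'_def span_zero)
      ultimately show "N \<inter> Q' = {0}" by auto
    qed
    then have le: "dim Q' \<le> dim Q" by (rule max)
    obtain C where C: "C \<subseteq> Q" "independent C" "Q \<subseteq> span C" "card C = dim Q"
      using basis_exists by blast
    have fC: "finite C"
      using independent_span_bound[OF fin(1) C(2)] fin(2) by auto
    have spC: "span C = Q" using C subQ by (metis span_minimal subset_antisym)
    have "independent (insert x C)"
      using C xQ spC by (intro independent_insertI) auto
    moreover have "insert x C \<subseteq> Q'" using C by (auto simp: Q'_def span_base)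
    ultimately have "card (insert x C) \<le> dim Q'"
    proof -
      assume i: "independent (insert x C)" and s: "insert x C \<subseteq> Q'"
      obtain C' where C': "C' \<subseteq> Q'" "independent C'" "Q' \<subseteq> span C'" "card C' = dim Q'"
        using basis_exists by blast
      have "finite C'" using independent_span_bound[OF fin(1) C'(2)] fin(2) by auto
      then show ?thesis using independent_span_bound[of C' "insert x C"] i s C' by auto
    qed
    moreover have "x \<notin> C" using C xQ by auto
    ultimately show False using le C fC by simp
  qed
  then have "span {x. \<forall>g\<in>\<T>. \<exists>c. g x = scale c x} \<subseteq> S"
    by (intro span_minimal subS) blast
  then have "x \<in> S" for x using eig by auto
  then have "\<exists>p q. x = p + q \<and> p \<in> N \<and> q \<in> Q" for x unfolding S_def by blast
  then have "\<exists>p\<in>N. x - p \<in> Q" for x by (metis add_diff_cancel_left')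
  then show ?thesis using Q unfolding P_def by blast
qed

text \<open>As long as they are nonzero, the vectors \<open>(T ^^ k) x\<close> are eigenvectors of
  \<open>g\<close> with distinct eigenvalues \<open>t ^ k * \<mu>\<close>, hence independent; there
  is no room for \<open>card B + 1\<close> of them.\<close>

lemma (in vector_space) shift_nilpotent:
  assumes fin: "finite B" "span B = UNIV" and g: "module_hom scale scale g" and T: "module_hom scale scale T"
    and gT: "\<And>y. g (T y) = scale t (T (g y))" and t: "t \<noteq> 0" "\<And>k::nat. k > 0 \<Longrightarrow> t ^ k \<noteq> 1"
    and gx: "g x = scale \<mu> x" and \<mu>: "\<mu> \<noteq> 0"
  shows "(T ^^ card B) x = 0"
proof (rule ccontr)
  assume ne: "(T ^^ card B) x \<noteq> 0"
  have pow: "module_hom scale scale (T ^^ k)" for k by (rule module_hom_pow[OF T])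
  define v where "v k = (T ^^ k) x" for k
  have v_nz: "v k \<noteq> 0" if "k < Suc (card B)" for k
  proof
    assume "v k = 0"
    moreover have "(T ^^ card B) x = (T ^^ (card B - k)) (v k)"
      using that unfolding v_def by (metis comp_apply funpow_add le_add_diff_inverse2 less_Suc_eq_le)
    ultimately show False using ne by (simp add: module_hom.zero[OF pow])
  qed
  have eig: "g (v k) = scale (t ^ k * \<mu>) (v k)" for k
    by (induction k) (simp_all add: v_def gx gT module_hom.scale[OF T] mult.assoc)
  have less: "t ^ i \<noteq> t ^ k" if "i < k" for i k :: nat
  proof -
    have "t ^ k = t ^ i * t ^ (k - i)" using that by (simp flip: power_add)
    then show ?thesis using t(2)[of "k - i"] t(1) that by simp
  qed
  have "inj_on (\<lambda>k. t ^ k * \<mu>) {..<Suc (card B)}"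
    using \<mu> less by (intro inj_onI) (metis mult_cancel_right nat_neq_iff)
  then have "inj_on v {..<Suc (card B)}" "independent (v ` {..<Suc (card B)})"
    using independent_eigenvectors[OF g eig v_nz] by auto
  then have "card (v ` {..<Suc (card B)}) \<le> card B"
    using independent_span_bound[OF fin(1)] fin(2) by auto
  then show False using \<open>inj_on v _\<close> by (simp add: card_image)
qed

section \<open>Modules as families of operators, and the adjoint action\<close>

locale gl_rep = vector_space scale
  for scale :: "'k::field \<Rightarrow> 'm::ab_group_add \<Rightarrow> 'm" +
  fixes n :: nat and r s :: 'k and G :: "gen \<Rightarrow> 'm \<Rightarrow> 'm" and B :: "'m set"
  assumes r0: "r \<noteq> 0" and s0: "s \<noteq> 0" and rs_pow: "\<And>k::nat. k > 0 \<Longrightarrow> r ^ k \<noteq> s ^ k"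
    and fin: "finite B" "span B = UNIV"
    and weight_vectors: "span {x. \<forall>g\<in>torus_gens n. \<exists>c. G g x = scale c x} = UNIV"
    and G_hom: "module_hom scale scale (G g)"
    and torus_comm: "g \<in> torus_gens n \<Longrightarrow> h \<in> torus_gens n \<Longrightarrow> G g (G h x) = G h (G g x)"
    and A_inv: "i \<in> {1..n} \<Longrightarrow> G (GA i) (G (GAinv i) x) = x"
    and B_inv: "i \<in> {1..n} \<Longrightarrow> G (GB i) (G (GBinv i) x) = x"
    and A_E: "i \<in> {1..n} \<Longrightarrow> j \<in> {1..<n} \<Longrightarrow>
      G (GA i) (G (GE j) x) = scale (r powi alpha j i) (G (GE j) (G (GA i) x))"
    and A_F: "i \<in> {1..n} \<Longrightarrow> j \<in> {1..<n} \<Longrightarrow>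
      G (GA i) (G (GF j) x) = scale (r powi (- alpha j i)) (G (GF j) (G (GA i) x))"
    and B_E: "i \<in> {1..n} \<Longrightarrow> j \<in> {1..<n} \<Longrightarrow>
      G (GB i) (G (GE j) x) = scale (s powi alpha j i) (G (GE j) (G (GB i) x))"
    and B_F: "i \<in> {1..n} \<Longrightarrow> j \<in> {1..<n} \<Longrightarrow>
      G (GB i) (G (GF j) x) = scale (s powi (- alpha j i)) (G (GF j) (G (GB i) x))"
    and E_F: "i \<in> {1..<n} \<Longrightarrow> j \<in> {1..<n} \<Longrightarrow>
      G (GE i) (G (GF j) x) - G (GF j) (G (GE i) x) =
        scale ((if i = j then 1 else 0) / (r - s)) (G (GA i) (G (GB (i + 1)) x) - G (GA (i + 1)) (G (GB i) x))"
    and E_E: "i \<in> {1..<n} \<Longrightarrow> j \<in> {1..<n} \<Longrightarrow> i + 1 < j \<Longrightarrow> G (GE i) (G (GE j) x) = G (GE j) (G (GE i) x)"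
    and F_F: "i \<in> {1..<n} \<Longrightarrow> j \<in> {1..<n} \<Longrightarrow> i + 1 < j \<Longrightarrow> G (GF i) (G (GF j) x) = G (GF j) (G (GF i) x)"
    and E_Serre: "1 \<le> i \<Longrightarrow> i + 1 < n \<Longrightarrow>
      G (GE i) (G (GE (i+1)) (G (GE (i+1)) x)) - scale (r + s) (G (GE (i+1)) (G (GE i) (G (GE (i+1)) x)))
        + scale (r * s) (G (GE (i+1)) (G (GE (i+1)) (G (GE i) x))) = 0"
begin

abbreviation "e j \<equiv> G (GE j)"
abbreviation "f j \<equiv> G (GF j)"
abbreviation "a j \<equiv> G (GA j)"
abbreviation "b j \<equiv> G (GB j)"
abbreviation "a' j \<equiv> G (GAinv j)"
abbreviation "b' j \<equiv> G (GBinv j)"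

lemmas G_simps [simp] = module_hom.add[OF G_hom] module_hom.diff[OF G_hom] module_hom.zero[OF G_hom]
  module_hom.scale[OF G_hom]

lemma torus_gensI [simp]: "i \<in> {1..n} \<Longrightarrow> GA i \<in> torus_gens n" "i \<in> {1..n} \<Longrightarrow> GB i \<in> torus_gens n"
  "i \<in> {1..n} \<Longrightarrow> GAinv i \<in> torus_gens n" "i \<in> {1..n} \<Longrightarrow> GBinv i \<in> torus_gens n"
  by (auto simp: torus_gens_def)

lemma A_inv': "i \<in> {1..n} \<Longrightarrow> a' i (a i x) = x"
  using A_inv[of i x] torus_comm[of "GAinv i" "GA i" x] by simp

lemma B_inv': "i \<in> {1..n} \<Longrightarrow> b' i (b i x) = x"
  using B_inv[of i x] torus_comm[of "GBinv i" "GB i" x] by simp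

lemma intertwine_inverse:
  assumes T: "\<And>x. g (T x) = scale c (T (g x))" and c: "c \<noteq> 0"
    and inv: "\<And>x. g (g' x) = x" "\<And>x. g' (g x) = x" and g': "module_hom scale scale g'"
  shows "g' (T x) = scale (inverse c) (T (g' x))"
proof -
  have "g' (g (T (g' x))) = scale c (g' (T x))"
    unfolding T inv by (simp add: module_hom.scale[OF g'])
  then have "T (g' x) = scale c (g' (T x))" by (simp add: inv)
  then show ?thesis using c by simp
qed

lemma A'_E: "i \<in> {1..n} \<Longrightarrow> j \<in> {1..<n} \<Longrightarrow> a' i (e j x) = scale (r powi (- alpha j i)) (e j (a' i x))"
  using intertwine_inverse[of "a i" "e j" "r powi alpha j i" "a' i" x] A_E A_inv A_inv' G_hom r0
  by (simp add: power_int_minus)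

lemma A'_F: "i \<in> {1..n} \<Longrightarrow> j \<in> {1..<n} \<Longrightarrow> a' i (f j x) = scale (r powi (alpha j i)) (f j (a' i x))"
  using intertwine_inverse[of "a i" "f j" "r powi (- alpha j i)" "a' i" x] A_F A_inv A_inv' G_hom r0
  by (simp add: power_int_minus)

lemma B'_E: "i \<in> {1..n} \<Longrightarrow> j \<in> {1..<n} \<Longrightarrow> b' i (e j x) = scale (s powi (- alpha j i)) (e j (b' i x))"
  using intertwine_inverse[of "b i" "e j" "s powi alpha j i" "b' i" x] B_E B_inv B_inv' G_hom s0
  by (simp add: power_int_minus)

lemma B'_F: "i \<in> {1..n} \<Longrightarrow> j \<in> {1..<n} \<Longrightarrow> b' i (f j x) = scale (s powi (alpha j i)) (f j (b' i x))"
  using intertwine_inverse[of "b i" "f j" "s powi (- alpha j i)" "b' i" x] B_F B_inv B_inv' G_hom s0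
  by (simp add: power_int_minus)

definition w :: "nat \<Rightarrow> 'm \<Rightarrow> 'm" where "w j x = a' (j + 1) (b' j x)"

lemma w_hom: "module_hom scale scale (w j)"
  unfolding w_def using module_hom_compose[OF G_hom G_hom] by (simp add: comp_def)

lemmas w_simps [simp] = module_hom.add[OF w_hom] module_hom.diff[OF w_hom] module_hom.zero[OF w_hom]
  module_hom.scale[OF w_hom]

lemma G_w: "g \<in> torus_gens n \<Longrightarrow> j \<in> {1..<n} \<Longrightarrow> G g (w j x) = w j (G g x)"
  unfolding w_def using torus_comm[of g "GAinv (j+1)"] torus_comm[of g "GBinv j"] by simp

lemma w_w: "i \<in> {1..<n} \<Longrightarrow> j \<in> {1..<n} \<Longrightarrow> w i (w j x) = w j (w i x)"
  using G_w[of "GAinv (i+1)" j] G_w[of "GBinv i" j] by (simp add: w_def[of i])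

lemma a_b_w: "j \<in> {1..<n} \<Longrightarrow> a (j + 1) (b j (w j x)) = x"
  using torus_comm[of "GB j" "GAinv (j+1)"] by (simp add: w_def A_inv B_inv)

lemma w_E: "i \<in> {1..<n} \<Longrightarrow> j \<in> {1..<n} \<Longrightarrow>
  w j (e i x) = scale (r powi (- alpha i (j+1)) * s powi (- alpha i j)) (e i (w j x))"
  by (simp add: w_def A'_E B'_E mult.commute)

lemma w_F: "i \<in> {1..<n} \<Longrightarrow> j \<in> {1..<n} \<Longrightarrow>
  w j (f i x) = scale (r powi (alpha i (j+1)) * s powi (alpha i j)) (f i (w j x))"
  by (simp add: w_def A'_F B'_F mult.commute)

text \<open>The adjoint action on linear maps that comes from \<open>\<Delta>(e\<^sub>j) = e\<^sub>j \<otimes> 1 + \<omega>\<^sub>j \<otimes> e\<^sub>j\<close> and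
  \<open>\<Delta>(f\<^sub>j) = 1 \<otimes> f\<^sub>j + f\<^sub>j \<otimes> \<omega>'\<^sub>j\<close>, where \<open>\<omega>\<^sub>j = a\<^sub>j b\<^sub>j\<^sub>+\<^sub>1\<close> and \<open>\<omega>'\<^sub>j = a\<^sub>j\<^sub>+\<^sub>1 b\<^sub>j\<close>; the inverse of \<open>\<omega>'\<^sub>j\<close> is \<open>w j\<close>.\<close>

definition adE :: "nat \<Rightarrow> ('m \<Rightarrow> 'm) \<Rightarrow> 'm \<Rightarrow> 'm" where
  "adE j \<phi> = (\<lambda>x. e j (\<phi> x) - a j (b (j + 1) (\<phi> (a' j (b' (j + 1) (e j x))))))"

definition adF :: "nat \<Rightarrow> ('m \<Rightarrow> 'm) \<Rightarrow> 'm \<Rightarrow> 'm" where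
  "adF j \<phi> = (\<lambda>x. f j (\<phi> (w j x)) - \<phi> (f j (w j x)))"

definition fscale :: "'k \<Rightarrow> ('m \<Rightarrow> 'm) \<Rightarrow> 'm \<Rightarrow> 'm" where
  "fscale c \<phi> = (\<lambda>x. scale c (\<phi> x))"

lemma vector_space_fscale: "vector_space fscale"
  by unfold_locales (simp_all add: fscale_def fun_eq_iff algebra_simps)

text \<open>The scalar by which \<omega>, the product of \<open>a j\<close> and
  \<open>b (j + 1)\<close>, acts in degree \<eta>.\<close>

definition \<kappa> :: "nat \<Rightarrow> (nat \<Rightarrow> int) \<Rightarrow> 'k" where
  "\<kappa> j \<eta> = r powi \<eta> j * s powi \<eta> (j + 1)"

lemma \<kappa>_add: "\<kappa> j (\<eta> + \<theta>) = \<kappa> j \<eta> * \<kappa> j \<theta>"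
  by (simp add: \<kappa>_def power_int_add r0 s0)

lemma \<kappa>_diff: "\<kappa> j (\<eta> - \<theta>) = \<kappa> j \<eta> / \<kappa> j \<theta>"
  by (simp add: \<kappa>_def power_int_diff r0 s0)

section \<open>Graded spaces of maps into a stable subspace\<close>

context
  fixes N :: "'m set"
  assumes N: "subspace N" and stable: "\<forall>g\<in>gens n. \<forall>x\<in>N. G g x \<in> N"
begin

lemma N_stable: "g \<in> gens n \<Longrightarrow> x \<in> N \<Longrightarrow> G g x \<in> N"
  using stable by blast

text \<open>The graded space of linear maps into \<open>N\<close> to which the graded theorem is applied: only the degree 0 part
  contains maps that are nonzero on \<open>N\<close>, and an invariant one is, up to a scalar, an equivariant
  projection onto \<open>N\<close>.\<close>

definition H :: "(nat \<Rightarrow> int) \<Rightarrow> ('m \<Rightarrow> 'm) set" where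
  "H \<eta> = {\<phi>. module_hom scale scale \<phi> \<and> (\<forall>x. \<phi> x \<in> N) \<and>
     (\<exists>c. (\<forall>x\<in>N. \<phi> x = scale c x) \<and> (\<eta> \<noteq> 0 \<longrightarrow> c = 0)) \<and>
     (\<forall>i\<in>{1..n}. \<forall>x. a i (\<phi> x) = scale (r powi \<eta> i) (\<phi> (a i x)) \<and>
                      b i (\<phi> x) = scale (s powi \<eta> i) (\<phi> (b i x)))}"

lemma H_iff:
  "\<phi> \<in> H \<eta> \<longleftrightarrow> module_hom scale scale \<phi> \<and> (\<forall>x. \<phi> x \<in> N) \<and>
     (\<exists>c. (\<forall>x\<in>N. \<phi> x = scale c x) \<and> (\<eta> \<noteq> 0 \<longrightarrow> c = 0)) \<and>
     (\<forall>i\<in>{1..n}. \<forall>x. a i (\<phi> x) = scale (r powi \<eta> i) (\<phi> (a i x)) \<and>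
                      b i (\<phi> x) = scale (s powi \<eta> i) (\<phi> (b i x)))"
  by (simp add: H_def)

lemma H_simps:
  assumes "\<phi> \<in> H \<eta>"
  shows "\<phi> (x + y) = \<phi> x + \<phi> y" "\<phi> (x - y) = \<phi> x - \<phi> y" "\<phi> 0 = 0" "\<phi> (scale c x) = scale c (\<phi> x)"
    "i \<in> {1..n} \<Longrightarrow> a i (\<phi> x) = scale (r powi \<eta> i) (\<phi> (a i x))"
    "i \<in> {1..n} \<Longrightarrow> b i (\<phi> x) = scale (s powi \<eta> i) (\<phi> (b i x))"
proof -
  have hom: "module_hom scale scale \<phi>" using assms by (simp add: H_def)
  show "\<phi> (x + y) = \<phi> x + \<phi> y" by (rule module_hom.add[OF hom])
  show "\<phi> (x - y) = \<phi> x - \<phi> y" by (rule module_hom.diff[OF hom])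
  show "\<phi> 0 = 0" by (rule module_hom.zero[OF hom])
  show "\<phi> (scale c x) = scale c (\<phi> x)" by (rule module_hom.scale[OF hom])
qed (use assms in \<open>simp_all add: H_def\<close>)

lemma gensI [simp]: "j \<in> {1..<n} \<Longrightarrow> GE j \<in> gens n" "j \<in> {1..<n} \<Longrightarrow> GF j \<in> gens n"
  "g \<in> torus_gens n \<Longrightarrow> g \<in> gens n"
  by (auto simp: gens_def)

lemma w_N: "j \<in> {1..<n} \<Longrightarrow> x \<in> N \<Longrightarrow> w j x \<in> N"
  unfolding w_def by (intro N_stable) auto

text \<open>Conjugation by the product of \<open>a j\<close> and \<open>b (j + 1)\<close> rescales a
  map of degree \<eta>, so the adjoint operator becomes a twisted commutator, the form treated by
  \<open>Serre_adjoint\<close>.\<close>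

lemma adE_H: 
  assumes "\<phi> \<in> H \<eta>" "j \<in> {1..<n}"
  shows "adE j \<phi> = (\<lambda>x. e j (\<phi> x) - scale (\<kappa> j \<eta>) (\<phi> (e j x)))"
proof
  fix x
  let ?y = "a' j (b' (j + 1) (e j x))"
  have j: "j \<in> {1..n}" "j + 1 \<in> {1..n}" using assms(2) by auto
  have "a j (b (j + 1) ?y) = b (j + 1) (a j ?y)" using torus_comm j by simp
  then have "a j (b (j + 1) ?y) = e j x" using j by (simp add: A_inv B_inv)
  then have "a j (b (j + 1) (\<phi> ?y)) = scale (\<kappa> j \<eta>) (\<phi> (e j x))"
    using j by (simp add: H_simps[OF assms(1)] \<kappa>_def mult.commute)
  then show "adE j \<phi> x = e j (\<phi> x) - scale (\<kappa> j \<eta>) (\<phi> (e j x))"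
    by (simp add: adE_def)
qed

text \<open>On \<open>N\<close>, where \<phi> is a scalar c, the twisted commutator equals
  \<open>e j\<close> times c (1 - \<open>\<kappa> j \<eta>\<close>). This is zero because
  \<open>\<kappa> j 0 = 1\<close> and c = 0 in all other degrees: the reason for the condition on c
  in \<open>H\<close>.\<close>

lemma adE_in_H:
  assumes p: "\<phi> \<in> H \<eta>" and j: "j \<in> {1..<n}"
  shows "adE j \<phi> \<in> H (\<eta> + alpha j)" "x \<in> N \<Longrightarrow> adE j \<phi> x = 0"
proof -
  have "\<phi> x \<in> N" for x using p by (simp add: H_def)
  then have range: "adE j \<phi> x \<in> N" for x
    unfolding adE_H[OF assms] using j N_stable by (intro subspace_diff[OF N] subspace_scale[OF N]) auto
  obtain c where c: "\<And>x. x \<in> N \<Longrightarrow> \<phi> x = scale c x" "\<eta> \<noteq> 0 \<Longrightarrow> c = 0"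
    using p unfolding H_def by blast
  show 0: "adE j \<phi> x = 0" if "x \<in> N" for x
  proof (cases "\<eta> = 0")
    case True
    then have "\<kappa> j \<eta> = 1" by (simp add: \<kappa>_def)
    then show ?thesis unfolding adE_H[OF assms] using that c(1) N_stable j by simp
  next
    case False
    then show ?thesis unfolding adE_H[OF assms] using that c N_stable j by simp
  qed
  have "module_hom scale scale (adE j \<phi>)"
    unfolding adE_H[OF assms] module_hom_iff
    by (intro conjI module_axioms allI) (simp_all add: H_simps[OF p] algebra_simps)
  moreover have "a i (adE j \<phi> x) = scale (r powi (\<eta> + alpha j) i) (adE j \<phi> (a i x))"
    "b i (adE j \<phi> x) = scale (s powi (\<eta> + alpha j) i) (adE j \<phi> (b i x))" if "i \<in> {1..n}" for i x
    unfolding adE_H[OF assms] using that j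
    by (simp_all add: H_simps[OF p] A_E B_E power_int_add r0 s0 algebra_simps)
  ultimately show "adE j \<phi> \<in> H (\<eta> + alpha j)"
    unfolding H_def using range 0 by (auto intro!: exI[of _ 0])
qed

lemma adF_in_H:
  assumes p: "\<phi> \<in> H \<eta>" and j: "j \<in> {1..<n}"
  shows "adF j \<phi> \<in> H (\<eta> - alpha j)" "x \<in> N \<Longrightarrow> adF j \<phi> x = 0"
proof -
  have "\<phi> x \<in> N" for x using p by (simp add: H_def)
  then have range: "adF j \<phi> x \<in> N" for x
    unfolding adF_def using j N_stable by (intro subspace_diff[OF N]) auto
  obtain c where c: "\<And>x. x \<in> N \<Longrightarrow> \<phi> x = scale c x" "\<eta> \<noteq> 0 \<Longrightarrow> c = 0"
    using p unfolding H_def by blast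
  show 0: "adF j \<phi> x = 0" if "x \<in> N" for x
    unfolding adF_def using that c(1) N_stable j w_N[OF j that] by simp
  have "module_hom scale scale (adF j \<phi>)"
    unfolding adF_def module_hom_iff
    by (intro conjI module_axioms allI) (simp_all add: H_simps[OF p] algebra_simps)
  moreover have "a i (adF j \<phi> x) = scale (r powi (\<eta> - alpha j) i) (adF j \<phi> (a i x))"
    "b i (adF j \<phi> x) = scale (s powi (\<eta> - alpha j) i) (adF j \<phi> (b i x))" if "i \<in> {1..n}" for i x
    unfolding adF_def using that j
    by (simp_all add: H_simps[OF p] A_F B_F G_w power_int_diff power_int_minus r0 s0 field_simps algebra_simps)
  ultimately show "adF j \<phi> \<in> H (\<eta> - alpha j)"
    unfolding H_def using range 0 by (auto intro!: exI[of _ 0])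
qed

text \<open>The mixed terms cancel, leaving commutators of \<open>e i\<close> and \<open>f j\<close>
  on both sides of \<phi>. For i = j their terms in \<open>a i\<close> and \<open>b (i + 1)\<close>
  cancel as well, and \<open>w j\<close> undoes the product of \<open>a (i + 1)\<close> and
  \<open>b i\<close>.\<close>

lemma adE_adF:
  assumes p: "\<phi> \<in> H \<eta>" and i: "i \<in> {1..<n}" and j: "j \<in> {1..<n}"
  shows "adE i (adF j \<phi>) = adF j (adE i \<phi>)
    + (if i = j then fscale (hval r s (\<eta> i) (\<eta> (i + 1))) \<phi> else 0)"
proof
  fix x
  define z where "z = w j x"
  define c where "c = (if i = j then 1 else 0) / (r - s)"
  have i': "i \<in> {1..n}" "i + 1 \<in> {1..n}" using i by auto
  \<comment> \<open>Moving \<open>w j\<close> past \<open>e i\<close> produces exactly the scalar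
    that compensates the degree shift by \<open>alpha j\<close>.\<close>
  have \<kappa>: "\<kappa> i (\<eta> - alpha j) * (r powi (- alpha i (j+1)) * s powi (- alpha i j)) = \<kappa> i \<eta>"
  proof -
    have "alpha i (j+1) = - alpha j i" "alpha i j = - alpha j (i+1)" by (auto simp: alpha_def eps_def)
    then show ?thesis unfolding \<kappa>_diff by (simp add: \<kappa>_def r0 s0)
  qed
  have 1: "adE i (adF j \<phi>) x = e i (f j (\<phi> z)) - e i (\<phi> (f j z))
      - scale (\<kappa> i \<eta>) (f j (\<phi> (e i z)) - \<phi> (f j (e i z)))"
    unfolding adE_H[OF adF_in_H(1)[OF p j] i] using \<kappa>
    by (simp add: adF_def w_E[OF i j] H_simps[OF p] z_def flip: scale_right_diff_distrib)
  have 2: "adF j (adE i \<phi>) x = f j (e i (\<phi> z)) - scale (\<kappa> i \<eta>) (f j (\<phi> (e i z)))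
      - e i (\<phi> (f j z)) + scale (\<kappa> i \<eta>) (\<phi> (e i (f j z)))"
    unfolding adE_H[OF p i] by (simp add: adF_def z_def algebra_simps)
  have "adE i (adF j \<phi>) x - adF j (adE i \<phi>) x
      = (e i (f j (\<phi> z)) - f j (e i (\<phi> z))) - scale (\<kappa> i \<eta>) (\<phi> (e i (f j z) - f j (e i z)))"
    unfolding 1 2 by (simp add: H_simps[OF p] algebra_simps)
  also have "\<dots> = scale c (scale (\<kappa> i \<eta>) (\<phi> (a i (b (i+1) z))) - scale (r powi \<eta> (i+1) * s powi \<eta> i) (\<phi> (a (i+1) (b i z))))
      - scale (\<kappa> i \<eta>) (scale c (\<phi> (a i (b (i+1) z)) - \<phi> (a (i+1) (b i z))))"
    unfolding E_F[OF i j] c_def[symmetric] using i' by (simp add: H_simps[OF p] \<kappa>_def mult.commute)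
  also have "\<dots> = scale (c * (\<kappa> i \<eta> - r powi \<eta> (i+1) * s powi \<eta> i)) (\<phi> (a (i+1) (b i z)))"
    by (simp add: algebra_simps)
  also have "\<dots> = (if i = j then fscale (hval r s (\<eta> i) (\<eta> (i + 1))) \<phi> else 0) x"
    using a_b_w[OF j] by (simp add: c_def z_def fscale_def hval_def \<kappa>_def)
  finally show "adE i (adF j \<phi>) x = (adF j (adE i \<phi>)
    + (if i = j then fscale (hval r s (\<eta> i) (\<eta> (i + 1))) \<phi> else 0)) x"
    by (simp add: algebra_simps)
qed

lemma adE_adE:
  assumes p: "\<phi> \<in> H \<eta>" and i: "i \<in> {1..<n}" and j: "j \<in> {1..<n}" and ij: "i + 1 < j"
  shows "adE i (adE j \<phi>) = adE j (adE i \<phi>)"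
proof -
  have "\<kappa> i (alpha j) = 1" "\<kappa> j (alpha i) = 1"
    using ij by (auto simp: \<kappa>_def alpha_def eps_def)
  then show ?thesis
    unfolding adE_H[OF adE_in_H(1)[OF p j] i] adE_H[OF adE_in_H(1)[OF p i] j] \<kappa>_add
    unfolding adE_H[OF p i] adE_H[OF p j]
    using E_E[OF i j ij] by (simp add: fun_eq_iff H_simps[OF p] algebra_simps)
qed

lemma adF_adF:
  assumes p: "\<phi> \<in> H \<eta>" and i: "i \<in> {1..<n}" and j: "j \<in> {1..<n}" and ij: "i + 1 < j"
  shows "adF i (adF j \<phi>) = adF j (adF i \<phi>)"
proof -
  have "alpha i (j + 1) = 0" "alpha i j = 0" "alpha j (i + 1) = 0" "alpha j i = 0"
    using ij by (auto simp: alpha_def eps_def)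
  then show ?thesis
    unfolding adF_def using F_F[OF i j ij] w_w[OF i j]
    by (simp add: fun_eq_iff H_simps[OF p] w_F[OF i j] w_F[OF j i] algebra_simps)
qed

lemma adE_Serre:
  assumes p: "\<phi> \<in> H \<eta>" and i: "1 \<le> i" "i + 1 < n"
  shows "adE i (adE (i+1) (adE (i+1) \<phi>)) - fscale (r + s) (adE (i+1) (adE i (adE (i+1) \<phi>)))
        + fscale (r * s) (adE (i+1) (adE (i+1) (adE i \<phi>))) = 0"
proof -
  have ii: "i \<in> {1..<n}" "i + 1 \<in> {1..<n}" using i by auto
  have \<kappa>_alpha: "\<kappa> i (alpha (i+1)) = s" "\<kappa> (i+1) (alpha i) = inverse r" "\<kappa> (i+1) (alpha (i+1)) = r * inverse s"
    by (simp_all add: \<kappa>_def alpha_def eps_def power_int_minus)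
  \<comment> \<open>Dividing by \<open>r * s\<close> brings all twists into the inverse-free form of
    \<open>Serre_adjoint\<close>.\<close>
  define q where "q = \<kappa> (i+1) \<eta> / (r * s)"
  have q: "\<kappa> (i+1) \<eta> = r * s * q" using r0 s0 by (simp add: q_def)
  have hom: "module_hom scale scale \<phi>" using p by (simp add: H_def)
  note H1 = adE_in_H(1)[OF p ii(1)] and H2 = adE_in_H(1)[OF p ii(2)]
  note H12 = adE_in_H(1)[OF H2 ii(1)] and H22 = adE_in_H(1)[OF H2 ii(2)] and H21 = adE_in_H(1)[OF H1 ii(2)]
  have k: "r * s * q * (r * inverse s) = r * r * q" "r * s * q * inverse r = s * q"
    "r * r * q * inverse r = r * q" "s * q * (r * inverse s) = r * q"
    using r0 s0 by (simp_all add: field_simps)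
  show ?thesis
    using Serre_adjoint[OF G_hom[of "GE i"] G_hom[of "GE (i+1)"] hom E_Serre[OF i], where ?k1.0 = "\<kappa> i \<eta>" and q = q]
    unfolding adE_H[OF H22 ii(1)] adE_H[OF H12 ii(2)] adE_H[OF H21 ii(2)]
    unfolding adE_H[OF H1 ii(2)] adE_H[OF H2 ii(1)] adE_H[OF H2 ii(2)]
    unfolding adE_H[OF p ii(1)] adE_H[OF p ii(2)] \<kappa>_add \<kappa>_alpha q k
    by (simp add: fun_eq_iff fscale_def)
qed

text \<open>\<open>(adE j ^^ K) \<phi>\<close> is a combination of the maps sending x to
  \<open>(e j ^^ i) (\<phi> ((e j ^^ k) x))\<close> with i + k = K. The hypothesis passes from
  \<phi> to \<open>adE j \<phi>\<close> with K lowered by one.\<close>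

lemma adE_pow_eq_0:
  assumes "\<phi> \<in> H \<eta>" and j: "j \<in> {1..<n}"
    and "\<And>i k x. i + k = K \<Longrightarrow> (e j ^^ i) (\<phi> ((e j ^^ k) x)) = 0"
  shows "(adE j ^^ K) \<phi> = 0"
  using assms(1,3)
proof (induction K arbitrary: \<phi> \<eta>)
  case 0
  show ?case using "0.prems"(2)[of 0 0] by (simp add: fun_eq_iff)
next
  case (Suc K)
  have pow: "module_hom scale scale (e j ^^ i)" for i
    by (rule module_hom_pow[OF G_hom])
  have "(e j ^^ i) (adE j \<phi> ((e j ^^ k) x)) = 0" if "i + k = K" for i k x
    using Suc.prems(2)[of "Suc i" k x] Suc.prems(2)[of i "Suc k" x] that
    unfolding adE_H[OF Suc.prems(1) j]
    by (simp add: module_hom.diff[OF pow] module_hom.scale[OF pow] funpow_swap1)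
  then have "(adE j ^^ K) (adE j \<phi>) = 0"
    by (intro Suc.IH[OF adE_in_H(1)[OF Suc.prems(1) j]]) auto
  then show ?case by (simp add: funpow_swap1)
qed

lemma adF_pow_eq_0:
  assumes "\<phi> \<in> H \<eta>" and j: "j \<in> {1..<n}"
    and "\<And>i k x. i + k = K \<Longrightarrow> (f j ^^ i) (\<phi> ((f j ^^ k) x)) = 0"
  shows "(adF j ^^ K) \<phi> = 0"
  using assms(1,3)
proof (induction K arbitrary: \<phi> \<eta>)
  case 0
  show ?case using "0.prems"(2)[of 0 0] by (simp add: fun_eq_iff)
next
  case (Suc K)
  have pow: "module_hom scale scale (f j ^^ i)" for i
    by (rule module_hom_pow[OF G_hom])
  \<comment> \<open>The extra factor \<open>w j\<close> is moved past the powers of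
    \<open>f j\<close> to the argument, at the cost of powers of \<open>c\<close>.\<close>
  define c where "c = r powi (alpha j (j+1)) * s powi (alpha j j)"
  have w_pow: "w j ((f j ^^ k) x) = scale (c ^ k) ((f j ^^ k) (w j x))" for k x
    by (induction k) (simp_all add: w_F[OF j j, folded c_def] mult.commute)
  have "(f j ^^ i) (adF j \<phi> ((f j ^^ k) x)) = 0" if "i + k = K" for i k x
    using Suc.prems(2)[of "Suc i" k "w j x"] Suc.prems(2)[of i "Suc k" "w j x"] that
    unfolding adF_def w_pow
    by (simp add: H_simps[OF Suc.prems(1)] module_hom.diff[OF pow] module_hom.scale[OF pow] funpow_swap1)
  then have "(adF j ^^ K) (adF j \<phi>) = 0"
    by (intro Suc.IH[OF adF_in_H(1)[OF Suc.prems(1) j]]) auto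
  then show ?case by (simp add: funpow_swap1)
qed

lemma subspace_H: "module.subspace fscale (H \<eta>)"
proof -
  interpret F: vector_space fscale by (rule vector_space_fscale)
  show ?thesis
  proof (rule F.subspaceI)
    show "0 \<in> H \<eta>"
      unfolding H_def using subspace_0[OF N]
      by (auto simp: module_hom_iff module_axioms intro!: exI[of _ 0])
    show "\<phi> + \<psi> \<in> H \<eta>" if p: "\<phi> \<in> H \<eta>" and q: "\<psi> \<in> H \<eta>" for \<phi> \<psi>
    proof -
      obtain c d where "\<And>x. x \<in> N \<Longrightarrow> \<phi> x = scale c x" "\<eta> \<noteq> 0 \<longrightarrow> c = 0"
        "\<And>x. x \<in> N \<Longrightarrow> \<psi> x = scale d x" "\<eta> \<noteq> 0 \<longrightarrow> d = 0"
        using p q unfolding H_def by blast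
      then have "\<exists>c. (\<forall>x\<in>N. (\<phi> + \<psi>) x = scale c x) \<and> (\<eta> \<noteq> 0 \<longrightarrow> c = 0)"
        by (intro exI[of _ "c + d"]) (auto simp: scale_left_distrib)
      moreover have "\<phi> x \<in> N" "\<psi> x \<in> N" for x using p q by (simp_all add: H_def)
      moreover have "module_hom scale scale (\<phi> + \<psi>)"
        unfolding module_hom_iff
        by (intro conjI module_axioms allI) (simp_all add: H_simps[OF p] H_simps[OF q] algebra_simps)
      ultimately show ?thesis
        unfolding H_def using subspace_add[OF N]
        by (auto simp: H_simps[OF p] H_simps[OF q] algebra_simps)
    qed
    show "fscale d \<phi> \<in> H \<eta>" if p: "\<phi> \<in> H \<eta>" for \<phi> d
    proof -
      obtain c where "\<And>x. x \<in> N \<Longrightarrow> \<phi> x = scale c x" "\<eta> \<noteq> 0 \<longrightarrow> c = 0"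
        using p unfolding H_def by blast
      then have "\<exists>c. (\<forall>x\<in>N. fscale d \<phi> x = scale c x) \<and> (\<eta> \<noteq> 0 \<longrightarrow> c = 0)"
        by (intro exI[of _ "d * c"]) (auto simp: fscale_def)
      moreover have "\<phi> x \<in> N" for x using p by (simp add: H_def)
      moreover have "module_hom scale scale (fscale d \<phi>)"
        unfolding module_hom_iff fscale_def
        by (intro conjI module_axioms allI) (simp_all add: H_simps[OF p] algebra_simps)
      ultimately show ?thesis
        unfolding H_def using subspace_scale[OF N]
        by (auto simp: H_simps[OF p] fscale_def mult.commute)
    qed
  qed
qed

end

text \<open>The eigenvalues of \<open>a j b j\<^sup>-\<^sup>1\<close> along an \<open>e j\<close>- or \<open>f j\<close>-string are distinct.\<close>

lemma E_F_nilpotent: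
  assumes j: "j \<in> {1..<n}"
  shows "(e j ^^ card B) x = 0" "(f j ^^ card B) x = 0"
proof -
  have j': "j \<in> {1..n}" using j by auto
  let ?g = "\<lambda>x. a j (b' j x)"
  have g: "module_hom scale scale ?g"
    using module_hom_compose[OF G_hom G_hom] by (simp add: comp_def)
  have alpha: "alpha j j = 1" by (simp add: alpha_def eps_def)
  have inj: "y = 0" if "?g y = 0" for y
    using that A_inv'[OF j', of "b' j y"] B_inv[OF j', of y] by simp
  have gE: "?g (e j y) = scale (r / s) (e j (?g y))" for y
    using A_E[OF j' j] B'_E[OF j' j] by (simp add: alpha power_int_minus divide_inverse mult.commute)
  have gF: "?g (f j y) = scale (s / r) (f j (?g y))" for y
    using A_F[OF j' j] B'_F[OF j' j] by (simp add: alpha power_int_minus divide_inverse)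
  have ne: "(r / s) ^ k \<noteq> 1" "(s / r) ^ k \<noteq> 1" if "k > 0" for k :: nat
    using rs_pow[OF that] r0 s0 by (auto simp: power_divide)
  have wt: "x \<in> {x. (T ^^ card B) x = 0}"
    if T: "module_hom scale scale T" "\<And>y. ?g (T y) = scale t (T (?g y))" "t \<noteq> 0" "\<And>k::nat. k > 0 \<Longrightarrow> t ^ k \<noteq> 1" for T t x
  proof -
    have pow: "module_hom scale scale (T ^^ k)" for k by (rule module_hom_pow[OF T(1)])
    have "(T ^^ card B) x = 0" if x: "\<forall>g\<in>torus_gens n. \<exists>c. G g x = scale c x" for x
    proof (cases "x = 0")
      case True
      then show ?thesis by (simp add: module_hom.zero[OF pow])
    next
      case False
      obtain c d where "a j x = scale c x" "b' j x = scale d x" using x j' torus_gensI by meson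
      then have gx: "?g x = scale (d * c) x" by simp
      then have "d * c \<noteq> 0" using False inj[of x] by auto
      from shift_nilpotent[OF fin g T gx this] show ?thesis .
    qed
    then have "span {x. \<forall>g\<in>torus_gens n. \<exists>c. G g x = scale c x} \<subseteq> {x. (T ^^ card B) x = 0}"
      by (intro span_minimal) (auto intro!: subspaceI simp: module_hom.add[OF pow] module_hom.scale[OF pow] module_hom.zero[OF pow])
    then show ?thesis using weight_vectors by auto
  qed
  show "(e j ^^ card B) x = 0"
    using wt[of "e j" "r / s" x] G_hom gE ne(1) r0 s0 by simp
  show "(f j ^^ card B) x = 0"
    using wt[of "f j" "s / r" x] G_hom gF ne(2) r0 s0 by simp
qed

section \<open>Equivariant complements\<close>

lemma graded_rep_H:
  assumes N: "subspace N" and N_stable: "\<forall>g\<in>gens n. \<forall>x\<in>N. G g x \<in> N"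
  shows "graded_rep fscale n r s (H N) adE adF {\<phi>. \<forall>x\<in>N. \<phi> x = 0}"
proof -
  interpret F: vector_space fscale by (rule vector_space_fscale)
  have pow: "module_hom scale scale (G g ^^ i)" for g i
    by (rule module_hom_pow[OF G_hom])
  \<comment> \<open>The exponent is twice the nilpotency bound so that one of i and k always reaches
    \<open>card B\<close>.\<close>
  have nil: "(G g ^^ i) (\<phi> ((G g ^^ k) x)) = 0"
    if G: "\<And>x. (G g ^^ card B) x = 0" and p: "\<phi> \<in> H N \<eta>" and ik: "i + k = 2 * card B" for g i k \<phi> \<eta> x
  proof -
    have G': "(G g ^^ i) x = 0" if "card B \<le> i" for i x
    proof -
      have "(G g ^^ i) x = (G g ^^ (i - card B)) ((G g ^^ card B) x)"
        using that by (metis comp_apply funpow_add le_add_diff_inverse2)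
      then show ?thesis by (simp add: G module_hom.zero[OF pow])
    qed
    have "card B \<le> i \<or> card B \<le> k" using ik by auto
    then show ?thesis
      using G' by (auto simp: H_simps[OF N N_stable p] module_hom.zero[OF pow])
  qed
  show ?thesis
  proof (intro graded_rep.intro F.vector_space_axioms graded_rep_axioms.intro)
    show "r \<noteq> 0" "s \<noteq> 0" by (rule r0 s0)+
    show "r ^ k \<noteq> s ^ k" if "k > 0" for k using rs_pow[OF that] .
    show "F.subspace (H N \<eta>)" for \<eta> by (rule subspace_H[OF N N_stable])
    show "F.subspace {\<phi>. \<forall>x\<in>N. \<phi> x = 0}"
      by (rule F.subspaceI) (auto simp: fscale_def)
    show "module_hom fscale fscale (adE j)" for j
      unfolding module_hom_iff using F.module_axioms
      by (auto simp: adE_def fscale_def fun_eq_iff algebra_simps)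
    show "module_hom fscale fscale (adF j)" for j
      unfolding module_hom_iff using F.module_axioms
      by (auto simp: adF_def fscale_def fun_eq_iff algebra_simps)
  next
    fix j \<phi> \<eta> assume j: "j \<in> {1..<n}" and p: "\<phi> \<in> H N \<eta>"
    show "adE j \<phi> \<in> H N (\<eta> + alpha j)" "adF j \<phi> \<in> H N (\<eta> - alpha j)"
      using adE_in_H(1)[OF N N_stable p j] adF_in_H(1)[OF N N_stable p j] by auto
    show "adE j \<phi> \<in> {\<phi>. \<forall>x\<in>N. \<phi> x = 0}" "adF j \<phi> \<in> {\<phi>. \<forall>x\<in>N. \<phi> x = 0}"
      using adE_in_H(2)[OF N N_stable p j] adF_in_H(2)[OF N N_stable p j] by auto
    have "(adE j ^^ (2 * card B)) \<phi> = 0"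
      using nil[OF E_F_nilpotent(1)[OF j] p] by (intro adE_pow_eq_0[OF N N_stable p j]) auto
    then show "\<exists>k. (adE j ^^ k) \<phi> = 0" ..
    have "(adF j ^^ (2 * card B)) \<phi> = 0"
      using nil[OF E_F_nilpotent(2)[OF j] p] by (intro adF_pow_eq_0[OF N N_stable p j]) auto
    then show "\<exists>k. (adF j ^^ k) \<phi> = 0" ..
    fix i assume i: "i \<in> {1..<n}"
    show "adE i (adF j \<phi>) = adF j (adE i \<phi>)
      + (if i = j then fscale (hval r s (\<eta> i) (\<eta> (i + 1))) \<phi> else 0)"
      by (rule adE_adF[OF N N_stable p i j])
    assume "i + 1 < j"
    then show "adE i (adE j \<phi>) = adE j (adE i \<phi>)" "adF i (adF j \<phi>) = adF j (adF i \<phi>)"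
      using adE_adE[OF N N_stable p i j] adF_adF[OF N N_stable p i j] by auto
  next
    fix i \<phi> \<eta> assume "1 \<le> i" "i + 1 < n" "\<phi> \<in> H N \<eta>"
    then show "adE i (adE (i+1) (adE (i+1) \<phi>)) - fscale (r + s) (adE (i+1) (adE i (adE (i+1) \<phi>)))
        + fscale (r * s) (adE (i+1) (adE (i+1) (adE i \<phi>))) = 0"
      using adE_Serre[OF N N_stable] by blast
  qed
qed

text \<open>The projection along a torus-stable complement has degree 0 and is the identity on
  \<open>N\<close>. It is traded for an invariant map \<phi> that is a nonzero scalar on
  \<open>N\<close>; the kernel of \<phi> is the complement.\<close>

theorem submodule_complement:
  assumes N: "subspace N" and N_stable: "\<forall>g\<in>gens n. \<forall>x\<in>N. G g x \<in> N"
  shows "\<exists>Q. subspace Q \<and> (\<forall>g\<in>gens n. \<forall>x\<in>Q. G g x \<in> Q) \<and> N \<inter> Q = {0} \<and> (\<forall>x. \<exists>p\<in>N. x - p \<in> Q)"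
proof (cases "N = {0}")
  \<comment> \<open>For N = 0 every map vanishes on \<open>N\<close>, so the invariant theorem would
    have no starting vector.\<close>
  case True
  then show ?thesis by (intro exI[of _ UNIV]) auto
next
  case False
  then obtain x\<^sub>0 where x0: "x\<^sub>0 \<in> N" "x\<^sub>0 \<noteq> 0" using subspace_0[OF N] by blast
  have torus: "g \<in> gens n" if "g \<in> torus_gens n" for g using that by (simp add: gens_def)
  obtain Q where Q: "subspace Q" "\<And>g x. g \<in> torus_gens n \<Longrightarrow> x \<in> Q \<Longrightarrow> G g x \<in> Q"
    and NQ: "N \<inter> Q = {0}" and decomp: "\<And>x. \<exists>p\<in>N. x - p \<in> Q"
  proof -
    have "\<exists>Q. subspace Q \<and> (\<forall>g\<in>G ` torus_gens n. \<forall>x\<in>Q. g x \<in> Q) \<and> N \<inter> Q = {0} \<and> (\<forall>x. \<exists>p\<in>N. x - p \<in> Q)"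
      using weight_vectors N_stable torus G_hom by (intro stable_complement[OF fin N]) auto
    then show ?thesis using that by blast
  qed
  obtain \<pi> where pi: "\<And>x. \<pi> x \<in> N" "\<And>x. x - \<pi> x \<in> Q"
    using decomp by metis
  have uniq: "\<pi> x = p" if "p \<in> N" "x - p \<in> Q" for x p
  proof -
    have "\<pi> x - p \<in> N" using subspace_diff[OF N pi(1) that(1)] .
    moreover have "(x - p) - (x - \<pi> x) \<in> Q" using subspace_diff[OF Q(1) that(2) pi(2)] .
    ultimately have "\<pi> x - p \<in> N \<inter> Q" by simp
    then show ?thesis using NQ by simp
  qed
  have pi_G: "\<pi> (G g x) = G g (\<pi> x)" if "g \<in> torus_gens n" for g x
    using Q(2)[OF that pi(2)[of x]] N_stable torus[OF that] pi(1) by (intro uniq) auto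
  have pi_N: "\<pi> x = x" if "x \<in> N" for x
    using that subspace_0[OF Q(1)] by (intro uniq) auto
  have "\<pi> (x + y) = \<pi> x + \<pi> y" for x y
    using subspace_add[OF Q(1) pi(2)[of x] pi(2)[of y]]
    by (intro uniq subspace_add[OF N] pi) (simp add: algebra_simps)
  moreover have "\<pi> (scale c x) = scale c (\<pi> x)" for c x
    using subspace_scale[OF Q(1) pi(2)[of x], of c]
    by (intro uniq subspace_scale[OF N] pi) (simp add: algebra_simps)
  ultimately have pi_hom: "module_hom scale scale \<pi>"
    unfolding module_hom_iff using module_axioms by blast
  have pi_c: "\<exists>c. (\<forall>x\<in>N. \<pi> x = scale c x)"
    using pi_N by (intro exI[of _ 1]) simp
  have "\<pi> \<in> H N 0"
    using pi(1) pi_hom pi_c pi_G by (simp add: H_iff[OF N N_stable])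
  moreover have "\<pi> \<notin> {\<phi>. \<forall>x\<in>N. \<phi> x = 0}" using x0 pi_N by auto
  ultimately have ex: "\<exists>\<phi>\<in>H N 0. \<phi> \<notin> {\<phi>. \<forall>x\<in>N. \<phi> x = 0}" by blast
  interpret R: graded_rep fscale n r s "H N" adE adF "{\<phi>. \<forall>x\<in>N. \<phi> x = 0}"
    by (rule graded_rep_H[OF N N_stable])
  obtain \<phi> where p: "\<phi> \<in> H N 0" and pL: "\<not> (\<forall>x\<in>N. \<phi> x = 0)"
    and inv: "\<And>j. j \<in> {1..<n} \<Longrightarrow> adE j \<phi> = 0" "\<And>j. j \<in> {1..<n} \<Longrightarrow> adF j \<phi> = 0"
    using R.exists_invariant[OF ex] unfolding mem_Collect_eq by blast
  note p_simps = H_simps[OF N N_stable p]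
  obtain c where c: "\<And>x. x \<in> N \<Longrightarrow> \<phi> x = scale c x"
    using H_iff[OF N N_stable, THEN iffD1, OF p] by blast
  have c0: "c \<noteq> 0" using pL c by auto
  have pN: "\<phi> x \<in> N" for x using H_iff[OF N N_stable, THEN iffD1, OF p] by blast
  have pe: "e j (\<phi> x) = \<phi> (e j x)" if j: "j \<in> {1..<n}" for j x
  proof -
    have "adE j \<phi> = (\<lambda>x. e j (\<phi> x) - scale (\<kappa> j 0) (\<phi> (e j x)))"
      by (rule adE_H[OF N N_stable p j])
    moreover have "\<kappa> j 0 = 1" by (simp add: \<kappa>_def)
    ultimately show ?thesis
      using fun_cong[OF inv(1)[OF j], of x] by simp
  qed
  have pf: "f j (\<phi> x) = \<phi> (f j x)" if j: "j \<in> {1..<n}" for j x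
  proof -
    have j': "j \<in> {1..n}" "j + 1 \<in> {1..n}" using j by auto
    \<comment> \<open>Evaluating \<open>adF j \<phi> = 0\<close> at \<open>a (j+1) (b j x)\<close>
      cancels the factor \<open>w j\<close>.\<close>
    have "w j (a (j+1) (b j x)) = x"
      using a_b_w[OF j, of x] G_w[OF _ j] j' by simp
    then show ?thesis
      using fun_cong[OF inv(2)[OF j], of "a (j+1) (b j x)"] by (simp add: adF_def)
  qed
  have pa: "a i (\<phi> x) = \<phi> (a i x)" "b i (\<phi> x) = \<phi> (b i x)" if "i \<in> {1..n}" for i x
    using p_simps(5,6)[OF that] by simp_all
  have pa': "a' i (\<phi> x) = \<phi> (a' i x)" if i: "i \<in> {1..n}" for i x
    using pa(1)[OF i, of "a' i x"] A_inv[OF i] A_inv'[OF i] by metis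
  have pb': "b' i (\<phi> x) = \<phi> (b' i x)" if i: "i \<in> {1..n}" for i x
    using pa(2)[OF i, of "b' i x"] B_inv[OF i] B_inv'[OF i] by metis
  have pG: "G g (\<phi> x) = \<phi> (G g x)" if "g \<in> gens n" for g x
    using that pe pf pa pa' pb' unfolding gens_def torus_gens_def by blast
  show ?thesis
  proof (intro exI[of _ "{x. \<phi> x = 0}"] conjI ballI allI)
    show "subspace {x. \<phi> x = 0}" by (rule subspaceI) (auto simp: p_simps)
    show "G g x \<in> {x. \<phi> x = 0}" if "g \<in> gens n" "x \<in> {x. \<phi> x = 0}" for g x
      using that pG[of g x, symmetric] by simp
    show "N \<inter> {x. \<phi> x = 0} = {0}"
      using c c0 subspace_0[OF N] p_simps(3) by auto
    fix x
    \<comment> \<open>After division by \<open>c\<close>, the map \<phi> is an equivariant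
      projection onto \<open>N\<close>.\<close>
    have "x - scale (inverse c) (\<phi> x) \<in> {x. \<phi> x = 0}"
      using c[OF pN[of x]] c0 by (simp add: p_simps)
    then show "\<exists>p\<in>N. x - p \<in> {x. \<phi> x = 0}"
      using subspace_scale[OF N pN[of x]] by blast
  qed
qed

end

section \<open>Modules over the quantum group\<close>

lemma poly_mapping_eq_sum_single:
  "p = (\<Sum>w\<in>Poly_Mapping.keys p. Poly_Mapping.single w (Poly_Mapping.lookup p w))"
proof (rule poly_mapping_eqI)
  fix w
  have "(\<Sum>v\<in>Poly_Mapping.keys p. Poly_Mapping.lookup (Poly_Mapping.single v (Poly_Mapping.lookup p v)) w)
     = (\<Sum>v\<in>Poly_Mapping.keys p. if v = w then Poly_Mapping.lookup p w else 0)"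
    by (rule sum.cong) (auto simp: lookup_single when_def)
  then show "Poly_Mapping.lookup p w
      = Poly_Mapping.lookup (\<Sum>w\<in>Poly_Mapping.keys p. Poly_Mapping.single w (Poly_Mapping.lookup p w)) w"
    by (simp add: lookup_sum in_keys_iff)
qed

text \<open>Centrality of the constants is what makes the elements of the algebra act by linear
  maps.\<close>

lemma free_const_commute: "free_const c * p = p * (free_const c :: 'g fmon \<Rightarrow>\<^sub>0 'k::comm_ring_1)"
proof -
  have "free_const c * Poly_Mapping.single w d = Poly_Mapping.single w d * free_const c" for w :: "'g fmon" and d
    by (simp add: free_const_def mult_single mult.commute)
  then show ?thesis
    by (subst (1 2) poly_mapping_eq_sum_single[of p]) (simp only: sum_distrib_left sum_distrib_right)
qed

section \<open>Evaluating the relators on a module\<close>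

locale Ugl_module = alg_module scale "Ugl n r s" "Ugl_const n r s" act
  for scale :: "'k::field \<Rightarrow> 'm::ab_group_add \<Rightarrow> 'm" and n :: nat and r s :: 'k
    and act :: "'k free_gl set \<Rightarrow> 'm \<Rightarrow> 'm"
begin

definition C :: "'k free_gl set" where "C = carrier (free_alg (gens n))"

text \<open>The action pulled back to the free algebra, where relators can be evaluated term by term
  without handling cosets.\<close>

definition \<rho> :: "'k free_gl \<Rightarrow> 'm \<Rightarrow> 'm" where "\<rho> p = act (Ugl_class n r s p)"

lemma C_iff: "p \<in> C \<longleftrightarrow> (\<forall>w \<in> Poly_Mapping.keys p. set (letters w) \<subseteq> gens n)"
  by (simp add: C_def free_alg_def)

lemma free_alg_ops: "p \<oplus>\<^bsub>free_alg (gens n)\<^esub> q = p + q" "p \<otimes>\<^bsub>free_alg (gens n)\<^esub> q = p * q"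
  "\<one>\<^bsub>free_alg (gens n)\<^esub> = (1 :: 'k free_gl)" for p q :: "'k free_gl"
  by (simp_all add: free_alg_def ring_of_type_algebra_def)

lemma C_add: "p \<in> C \<Longrightarrow> q \<in> C \<Longrightarrow> p + q \<in> C"
  using ring.ring_simprules(1)[OF ring_free_alg, of p "gens n" q] by (simp add: C_def free_alg_ops)

lemma C_mult: "p \<in> C \<Longrightarrow> q \<in> C \<Longrightarrow> p * q \<in> C"
  using ring.ring_simprules(5)[OF ring_free_alg, of p "gens n" q] by (simp add: C_def free_alg_ops)

lemma C_one: "1 \<in> C"
  by (simp add: C_iff zero_fmon_def)

lemma C_zero: "0 \<in> C"
  by (simp add: C_iff)

lemma C_uminus: "p \<in> C \<Longrightarrow> - p \<in> C"
  by (simp add: C_iff)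

lemma C_diff: "p \<in> C \<Longrightarrow> q \<in> C \<Longrightarrow> p - q \<in> C"
  using C_add[OF _ C_uminus, of p q] by simp

lemma C_const: "free_const c \<in> C"
  by (simp add: C_iff free_const_def zero_fmon_def)

lemma C_gen: "g \<in> gens n \<Longrightarrow> free_gen g \<in> C"
  by (simp add: C_iff free_gen_def)

lemmas C_intros = C_add C_mult C_one C_zero C_diff C_const C_gen

lemma Ugl_class_hom: "Ugl_class n r s \<in> ring_hom (free_alg (gens n)) (Ugl n r s)"
  using ideal.rcos_ring_hom[OF ideal_rel_ideal] by (simp add: Ugl_class_def[abs_def] Ugl_def)

lemma Ugl_class_closed: "p \<in> C \<Longrightarrow> Ugl_class n r s p \<in> carrier (Ugl n r s)"
  using ring_hom_closed[OF Ugl_class_hom] by (simp add: C_def)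

lemma carrier_Ugl: "carrier (Ugl n r s) = Ugl_class n r s ` C"
  by (auto simp: Ugl_def FactRing_def A_RCOSETS_def' Ugl_class_def C_def)

lemma \<rho>_add: "p \<in> C \<Longrightarrow> q \<in> C \<Longrightarrow> \<rho> (p + q) m = \<rho> p m + \<rho> q m"
  using ring_hom_add[OF Ugl_class_hom, of p q] act_add_left Ugl_class_closed
  by (simp add: \<rho>_def free_alg_ops C_def)

lemma \<rho>_mult: "p \<in> C \<Longrightarrow> q \<in> C \<Longrightarrow> \<rho> (p * q) m = \<rho> p (\<rho> q m)"
  using ring_hom_mult[OF Ugl_class_hom, of p q] act_mult Ugl_class_closed
  by (simp add: \<rho>_def free_alg_ops C_def)

lemma \<rho>_one: "\<rho> 1 m = m"
  using ring_hom_one[OF Ugl_class_hom] act_one by (simp add: \<rho>_def free_alg_ops)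

lemma \<rho>_const: "\<rho> (free_const c) m = scale c m"
  using act_const by (simp add: \<rho>_def Ugl_const_def)

lemma \<rho>_zero: "\<rho> 0 m = 0"
  using \<rho>_add[OF C_zero C_zero, of m] by simp

lemma \<rho>_diff: "p \<in> C \<Longrightarrow> q \<in> C \<Longrightarrow> \<rho> (p - q) m = \<rho> p m - \<rho> q m"
  using \<rho>_add[OF C_diff, of p q q m] by simp

lemmas \<rho>_simps = \<rho>_add \<rho>_mult \<rho>_one \<rho>_const \<rho>_zero \<rho>_diff

lemma \<rho>_hom:
  assumes "p \<in> C"
  shows "module_hom scale scale (\<rho> p)"
proof -
  have "\<rho> p (x + y) = \<rho> p x + \<rho> p y" for x y
    using act_add_right[OF Ugl_class_closed[OF assms]] by (simp add: \<rho>_def)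
  moreover have "\<rho> p (scale c x) = scale c (\<rho> p x)" for c x
    using \<rho>_mult[OF C_const assms, of c x] \<rho>_mult[OF assms C_const, of c x]
    by (simp add: free_const_commute \<rho>_const)
  ultimately show ?thesis unfolding module_hom_iff using module_axioms by blast
qed

lemma \<rho>_relator:
  assumes "p \<in> relators n r s"
  shows "\<rho> p m = 0"
proof -
  have "p \<in> rel_ideal n r s"
    using ring.genideal_self[OF ring_free_alg relators_in_carrier] assms unfolding rel_ideal_def by blast
  moreover have "0 \<in> rel_ideal n r s"
    using additive_subgroup.zero_closed[OF ideal.axioms(1)[OF ideal_rel_ideal]]
    by (simp add: free_alg_def ring_of_type_algebra_def)
  moreover have "abelian_subgroup (rel_ideal n r s) (free_alg (gens n))"
    by (rule abelian_subgroupI3[OF ideal.axioms(1)[OF ideal_rel_ideal] ring.is_abelian_group[OF ring_free_alg]])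
  ultimately have "Ugl_class n r s p = Ugl_class n r s 0"
    unfolding Ugl_class_def by (simp add: abelian_subgroup.a_rcos_const)
  then show ?thesis using \<rho>_zero by (simp add: \<rho>_def)
qed

text \<open>Generators suffice because every element of the algebra is the class of a finite sum of
  scaled words, and a word acts by its letters in succession.\<close>

lemma is_submodule_iff:
  "is_submodule N \<longleftrightarrow> subspace N \<and> (\<forall>g\<in>gens n. \<forall>x\<in>N. \<rho> (free_gen g) x \<in> N)"
proof (intro iffI conjI ballI)
  assume N: "is_submodule N"
  then show "subspace N" by (simp add: is_submodule_def)
  show "\<rho> (free_gen g) x \<in> N" if "g \<in> gens n" "x \<in> N" for g x
    using N that Ugl_class_closed[OF C_gen] by (simp add: is_submodule_def \<rho>_def)
next
  assume N: "subspace N \<and> (\<forall>g\<in>gens n. \<forall>x\<in>N. \<rho> (free_gen g) x \<in> N)"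
  have word: "Poly_Mapping.single (Word l) c \<in> C \<and> \<rho> (Poly_Mapping.single (Word l) c) x \<in> N"
    if "set l \<subseteq> gens n" "x \<in> N" for l c x
    using that(1)
  proof (induction l)
    case Nil
    have "Poly_Mapping.single (Word ([] :: gen list)) c = free_const c" by (simp add: free_const_def zero_fmon_def)
    then show ?case using N that(2) by (simp add: C_const \<rho>_const subspace_scale)
  next
    case (Cons g l)
    have "Poly_Mapping.single (Word (g # l)) c = free_gen g * Poly_Mapping.single (Word l) c"
      by (simp add: free_gen_def mult_single plus_fmon_def)
    then show ?case using Cons N C_gen by (simp add: C_mult \<rho>_mult)
  qed
  have sum: "(\<Sum>w\<in>W. Poly_Mapping.single w (c w)) \<in> C \<and> \<rho> (\<Sum>w\<in>W. Poly_Mapping.single w (c w)) x \<in> N"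
    if "finite W" "\<forall>w\<in>W. set (letters w) \<subseteq> gens n" "x \<in> N" for W c x
    using that(1,2)
  proof (induction W)
    case empty
    then show ?case using N subspace_0 by (simp add: C_zero \<rho>_zero)
  next
    case (insert w W)
    then show ?case using word[of "letters w" x "c w"] that(3) N
      by (simp add: C_add \<rho>_add subspace_add)
  qed
  have "\<rho> p x \<in> N" if "p \<in> C" "x \<in> N" for p x
    using sum[of "Poly_Mapping.keys p" x "Poly_Mapping.lookup p"] that
    by (simp add: C_iff flip: poly_mapping_eq_sum_single)
  then show "is_submodule N"
    using N by (auto simp: is_submodule_def carrier_Ugl \<rho>_def)
qed

text \<open>The operators of \<open>gl_rep\<close> must be linear for every index, but
  \<open>act\<close> is unconstrained off the carrier; hence the default 0 outside
  \<open>gens n\<close>.\<close>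

definition gact :: "gen \<Rightarrow> 'm \<Rightarrow> 'm" where
  "gact g = (if g \<in> gens n then \<rho> (free_gen g) else (\<lambda>_. 0))"

lemma gact_hom: "module_hom scale scale (gact g)"
  using \<rho>_hom[OF C_gen] by (simp add: gact_def module_hom_iff module_axioms)

text \<open>Each eigenspace of the torus algebra consists of common eigenvectors of the torus
  generators, and a direct sum is spanned by its summands. From here on the characters themselves
  are forgotten.\<close>

lemma weight_vectors:
  assumes "acts_semisimply (Ugl0 n r s) \<Omega>"
  shows "span {x. \<forall>g\<in>torus_gens n. \<exists>c. gact g x = scale c x} = UNIV"
proof -
  let ?W = "{x. \<forall>g\<in>torus_gens n. \<exists>c. gact g x = scale c x}"
  have eig: "eigenspace (Ugl0 n r s) \<chi> \<subseteq> ?W" for \<chi>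
  proof
    fix x assume x: "x \<in> eigenspace (Ugl0 n r s) \<chi>"
    have "gact g x = scale (\<chi> (Ugl_class n r s (free_gen g))) x" if "g \<in> torus_gens n" for g
    proof -
      have "Ugl_class n r s (free_gen g) \<in> Ugl0 n r s"
        unfolding Ugl0_def using that by (intro generate_ring.incl) blast
      moreover have "g \<in> gens n" using that by (simp add: gens_def)
      ultimately show ?thesis using x by (simp add: eigenspace_def gact_def \<rho>_def)
    qed
    then show "x \<in> ?W" by blast
  qed
  have "m \<in> span ?W" for m
  proof -
    obtain x where x: "\<forall>i\<in>\<Omega>. x i \<in> eigenspace (Ugl0 n r s) i" "\<forall>i. i \<notin> \<Omega> \<longrightarrow> x i = 0"
      "m = (\<Sum>i | x i \<noteq> 0. x i)"
      using assms unfolding acts_semisimply_def is_direct_sum_def by metis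
    have "x i \<in> ?W" if "x i \<noteq> 0" for i using x(1,2) eig that by blast
    then show ?thesis unfolding x(3) by (intro span_sum span_base) blast
  qed
  then show ?thesis by blast
qed

lemma ip_alpha: "i \<in> {1..n} \<Longrightarrow> ip n (eps i) (alpha j) = alpha j i"
  by (simp add: ip_def eps_def if_distrib[of "\<lambda>z. z * _"] cong: if_cong)

lemma gl_rep_gact:
  assumes rs: "r \<noteq> 0" "s \<noteq> 0" "\<not> (\<exists>k>0. (r * inverse s) ^ k = 1)"
    and fin: "finite B" "span B = UNIV"
    and semisimple: "acts_semisimply (Ugl0 n r s) \<Omega>"
  shows "gl_rep scale n r s gact B"
proof (intro gl_rep.intro vector_space_axioms gl_rep_axioms.intro)
  show "r \<noteq> 0" "s \<noteq> 0" by (rule rs)+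
  show "r ^ k \<noteq> s ^ k" if "k > 0" for k
  proof
    assume "r ^ k = s ^ k"
    then have "(r * inverse s) ^ k = 1" using rs(2) by (simp add: power_mult_distrib power_inverse)
    then show False using rs(3) that by blast
  qed
  show "finite B" "span B = UNIV" by (rule fin)+
  show "span {x. \<forall>g\<in>torus_gens n. \<exists>c. gact g x = scale c x} = UNIV"
    by (rule weight_vectors[OF semisimple])
  show "module_hom scale scale (gact g)" for g by (rule gact_hom)
next
  fix g h x assume gh: "g \<in> torus_gens n" "h \<in> torus_gens n"
  \<comment> \<open>The unions in \<open>relators\<close> nest to the left: here and below, each
    \<open>UnI1\<close> skips one family from the end, and \<open>UnI2\<close> selects a family
    other than the first.\<close>
  have "free_gen g * free_gen h - free_gen h * free_gen g \<in> relators n r s"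
    unfolding relators_def Let_def
    by (rule UnI1, rule UnI1, rule UnI1, rule UnI1, rule UnI1, rule UnI1, rule UnI1, rule UnI1, rule UnI1, rule UnI1, rule UnI1, rule UnI1, rule UnI1, rule CollectI, intro exI conjI, rule refl) (use gh in simp_all)
  from \<rho>_relator[OF this, of x] show "gact g (gact h x) = gact h (gact g x)"
    using gh by (simp add: \<rho>_simps C_intros gact_def gens_def)
next
  fix i x assume i: "i \<in> {1..n}"
  then have g: "GA i \<in> gens n" "GAinv i \<in> gens n" "GB i \<in> gens n" "GBinv i \<in> gens n"
    by (auto simp: gens_def torus_gens_def)
  have "free_gen (GA i) * free_gen (GAinv i) - 1 \<in> relators n r s"
    unfolding relators_def Let_def
    by (rule UnI1, rule UnI1, rule UnI1, rule UnI1, rule UnI1, rule UnI1, rule UnI1, rule UnI1, rule UnI1, rule UnI1, rule UnI1, rule UnI1, rule UnI2, rule CollectI, intro exI conjI, rule refl) (use i in simp_all)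
  from \<rho>_relator[OF this, of x] show "gact (GA i) (gact (GAinv i) x) = x"
    using g by (simp add: \<rho>_simps C_intros gact_def)
  have "free_gen (GB i) * free_gen (GBinv i) - 1 \<in> relators n r s"
    unfolding relators_def Let_def
    by (rule UnI1, rule UnI1, rule UnI1, rule UnI1, rule UnI1, rule UnI1, rule UnI1, rule UnI1, rule UnI1, rule UnI1, rule UnI1, rule UnI2, rule CollectI, intro exI conjI, rule refl) (use i in simp_all)
  from \<rho>_relator[OF this, of x] show "gact (GB i) (gact (GBinv i) x) = x"
    using g by (simp add: \<rho>_simps C_intros gact_def)
next
  fix i j x assume i: "i \<in> {1..n}" and j: "j \<in> {1..<n}"
  then have g: "GA i \<in> gens n" "GB i \<in> gens n" "GE j \<in> gens n" "GF j \<in> gens n"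
    by (auto simp: gens_def torus_gens_def)
  note ip = ip_alpha[OF i, of j]
  have "free_gen (GA i) * free_gen (GE j) - free_const (r powi ip n (eps i) (alpha j)) * free_gen (GE j) * free_gen (GA i) \<in> relators n r s"
    unfolding relators_def Let_def
    by (rule UnI1, rule UnI1, rule UnI1, rule UnI1, rule UnI1, rule UnI1, rule UnI1, rule UnI1, rule UnI1, rule UnI1, rule UnI2, rule CollectI, intro exI conjI, rule refl) (use i j in simp_all)
  from \<rho>_relator[OF this, of x] show "gact (GA i) (gact (GE j) x) = scale (r powi alpha j i) (gact (GE j) (gact (GA i) x))"
    using g by (simp add: \<rho>_simps C_intros gact_def ip)
  have "free_gen (GA i) * free_gen (GF j) - free_const (r powi (- ip n (eps i) (alpha j))) * free_gen (GF j) * free_gen (GA i) \<in> relators n r s"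
    unfolding relators_def Let_def
    by (rule UnI1, rule UnI1, rule UnI1, rule UnI1, rule UnI1, rule UnI1, rule UnI1, rule UnI1, rule UnI1, rule UnI2, rule CollectI, intro exI conjI, rule refl) (use i j in simp_all)
  from \<rho>_relator[OF this, of x] show "gact (GA i) (gact (GF j) x) = scale (r powi (- alpha j i)) (gact (GF j) (gact (GA i) x))"
    using g by (simp add: \<rho>_simps C_intros gact_def ip)
  have "free_gen (GB i) * free_gen (GE j) - free_const (s powi ip n (eps i) (alpha j)) * free_gen (GE j) * free_gen (GB i) \<in> relators n r s"
    unfolding relators_def Let_def
    by (rule UnI1, rule UnI1, rule UnI1, rule UnI1, rule UnI1, rule UnI1, rule UnI1, rule UnI1, rule UnI2, rule CollectI, intro exI conjI, rule refl) (use i j in simp_all)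
  from \<rho>_relator[OF this, of x] show "gact (GB i) (gact (GE j) x) = scale (s powi alpha j i) (gact (GE j) (gact (GB i) x))"
    using g by (simp add: \<rho>_simps C_intros gact_def ip)
  have "free_gen (GB i) * free_gen (GF j) - free_const (s powi (- ip n (eps i) (alpha j))) * free_gen (GF j) * free_gen (GB i) \<in> relators n r s"
    unfolding relators_def Let_def
    by (rule UnI1, rule UnI1, rule UnI1, rule UnI1, rule UnI1, rule UnI1, rule UnI1, rule UnI2, rule CollectI, intro exI conjI, rule refl) (use i j in simp_all)
  from \<rho>_relator[OF this, of x] show "gact (GB i) (gact (GF j) x) = scale (s powi (- alpha j i)) (gact (GF j) (gact (GB i) x))"
    using g by (simp add: \<rho>_simps C_intros gact_def ip)
next
  fix i j x assume i: "i \<in> {1..<n}" and j: "j \<in> {1..<n}"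
  then have g: "GE i \<in> gens n" "GE j \<in> gens n" "GF i \<in> gens n" "GF j \<in> gens n"
    "GA i \<in> gens n" "GB i \<in> gens n" "GA (i + 1) \<in> gens n" "GB (i + 1) \<in> gens n"
    by (auto simp: gens_def torus_gens_def)
  have "(free_gen (GE i) * free_gen (GF j) - free_gen (GF j) * free_gen (GE i))
        - free_const ((if i = j then 1 else 0) / (r - s)) * (free_gen (GA i) * free_gen (GB (i + 1))
          - free_gen (GA (i + 1)) * free_gen (GB i)) \<in> relators n r s"
    unfolding relators_def Let_def
    by (rule UnI1, rule UnI1, rule UnI1, rule UnI1, rule UnI1, rule UnI1, rule UnI2, rule CollectI, intro exI conjI, rule refl) (use i j in simp_all)
  from \<rho>_relator[OF this, of x] show "gact (GE i) (gact (GF j) x) - gact (GF j) (gact (GE i) x) =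
        scale ((if i = j then 1 else 0) / (r - s)) (gact (GA i) (gact (GB (i + 1)) x) - gact (GA (i + 1)) (gact (GB i) x))"
    using g by (simp add: \<rho>_simps C_intros gact_def del: One_nat_def Nat.add_Suc_right Nat.add_0_right)
  assume "i + 1 < j"
  then have ij: "\<bar>int i - int j\<bar> > 1" by simp
  have "free_gen (GE i) * free_gen (GE j) - free_gen (GE j) * free_gen (GE i) \<in> relators n r s"
    unfolding relators_def Let_def
    by (rule UnI1, rule UnI1, rule UnI1, rule UnI1, rule UnI1, rule UnI2, rule CollectI, intro exI conjI, rule refl) (use ij i j in simp_all)
  from \<rho>_relator[OF this, of x] show "gact (GE i) (gact (GE j) x) = gact (GE j) (gact (GE i) x)"
    using g by (simp add: \<rho>_simps C_intros gact_def)
  have "free_gen (GF i) * free_gen (GF j) - free_gen (GF j) * free_gen (GF i) \<in> relators n r s"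
    unfolding relators_def Let_def
    by (rule UnI1, rule UnI1, rule UnI1, rule UnI1, rule UnI2, rule CollectI, intro exI conjI, rule refl) (use ij i j in simp_all)
  from \<rho>_relator[OF this, of x] show "gact (GF i) (gact (GF j) x) = gact (GF j) (gact (GF i) x)"
    using g by (simp add: \<rho>_simps C_intros gact_def)
next
  fix i x assume i: "1 \<le> i" "i + 1 < n"
  then have i': "i \<in> {1..<n}" "i + 1 \<in> {1..<n}" by auto
  then have g: "GE i \<in> gens n" "GE (i + 1) \<in> gens n" by (auto simp: gens_def)
  have "free_gen (GE i) * (free_gen (GE (i+1)))^2
      - free_const (r + s) * free_gen (GE (i+1)) * free_gen (GE i) * free_gen (GE (i+1))
      + free_const (r * s) * (free_gen (GE (i+1)))^2 * free_gen (GE i) \<in> relators n r s"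
    unfolding relators_def Let_def
    by (rule UnI1, rule UnI1, rule UnI2, rule CollectI, intro exI conjI, rule refl) (use i' in simp_all)
  from \<rho>_relator[OF this, of x] show "gact (GE i) (gact (GE (i+1)) (gact (GE (i+1)) x))
      - scale (r + s) (gact (GE (i+1)) (gact (GE i) (gact (GE (i+1)) x)))
      + scale (r * s) (gact (GE (i+1)) (gact (GE (i+1)) (gact (GE i) x))) = 0"
    using g by (simp add: \<rho>_simps C_intros gact_def power2_eq_square)
qed

end

section \<open>From complements to simple summands\<close>

context alg_module
begin

text \<open>Induction on the dimension: a nonzero submodule \<open>T\<close> of \<open>N\<close> of
  least dimension is simple, and a complement of \<open>T\<close> cuts \<open>N\<close> down to a
  smaller submodule. Uniqueness is stated for sums equal to 0, which is enough after
  subtraction.\<close>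

lemma decomposition_into_simples:
  assumes fin: "finite_dim"
    and compl: "\<forall>N. is_submodule N \<longrightarrow>
      (\<exists>Q. is_submodule Q \<and> N \<inter> Q = {0} \<and> (\<forall>x. \<exists>p\<in>N. x - p \<in> Q))"
    and N: "is_submodule N"
  shows "\<exists>S. finite S \<and> (\<forall>T\<in>S. simple_submodule T \<and> T \<subseteq> N) \<and>
    (\<forall>m\<in>N. \<exists>x. (\<forall>T\<in>S. x T \<in> T) \<and> m = (\<Sum>T\<in>S. x T)) \<and>
    (\<forall>x. (\<forall>T\<in>S. x T \<in> T) \<and> (\<Sum>T\<in>S. x T) = 0 \<longrightarrow> (\<forall>T\<in>S. x T = 0))"
proof -
  obtain B0 where B0: "finite B0" "span B0 = UNIV" using fin by (auto simp: finite_dim_def)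
  obtain B where B: "independent B" "UNIV \<subseteq> span B" using basis_exists by metis
  have "finite B" using independent_span_bound[OF B0(1) B(1)] B0(2) by auto
  then interpret finite_dimensional_vector_space scale B using B by unfold_locales auto
  have sub: "subspace N" if "is_submodule N" for N using that by (simp add: is_submodule_def)
  have dim_less: "dim M < dim N" if "is_submodule M" "is_submodule N" "M \<subset> N" for M N
    using that sub by (intro dim_psubset) (metis span_eq_iff)
  show ?thesis using N
  proof (induction "dim N" arbitrary: N rule: less_induct)
    case less
    note N = less.prems
    show ?case
    proof (cases "N = {0}")
      case True
      then show ?thesis by (intro exI[of _ "{}"]) auto
    next
      case False
      define P where "P T \<longleftrightarrow> is_submodule T \<and> T \<subseteq> N \<and> T \<noteq> {0}" for T
      have "P N" using N False by (simp add: P_def)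
      then obtain T where T: "P T" and min: "\<And>T'. P T' \<Longrightarrow> dim T \<le> dim T'"
        using ex_has_least_nat[of P N dim] by blast
      have T': "is_submodule T" "T \<subseteq> N" "T \<noteq> {0}" using T by (auto simp: P_def)
      have simple: "simple_submodule T"
        unfolding simple_submodule_def
      proof (intro conjI allI impI)
        fix T' assume *: "is_submodule T' \<and> T' \<subseteq> T"
        show "T' = {0} \<or> T' = T"
        proof (rule ccontr)
          assume "\<not> (T' = {0} \<or> T' = T)"
          then have "P T'" "T' \<subset> T" using * T' by (auto simp: P_def)
          then show False using min[of T'] dim_less[of T' T] * T' by auto
        qed
      qed (use T' in auto)
      obtain Q where Q: "is_submodule Q" "T \<inter> Q = {0}" "\<forall>x. \<exists>p\<in>T. x - p \<in> Q"
        using compl[rule_format, OF T'(1)] by (elim exE conjE) (rule that)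
      \<comment> \<open>Since \<open>T\<close> lies in \<open>N\<close>, the modular law makes
        \<open>N \<inter> Q\<close> a complement of \<open>T\<close> inside
        \<open>N\<close>.\<close>
      define M where "M = N \<inter> Q"
      have M: "is_submodule M" unfolding M_def is_submodule_def
        using N Q(1) by (auto simp: is_submodule_def intro: subspace_inter)
      have "M \<noteq> N"
      proof
        assume "M = N"
        then have "T \<subseteq> T \<inter> Q" using T'(2) unfolding M_def by blast
        then show False using Q(2) T'(3) subspace_0[OF sub[OF T'(1)]] by blast
      qed
      then have "dim M < dim N" using M N by (intro dim_less) (auto simp: M_def)
      from less.hyps[OF this M] obtain S where S: "finite S" "\<forall>T\<in>S. simple_submodule T \<and> T \<subseteq> M"
        and ex: "\<forall>m\<in>M. \<exists>x. (\<forall>T\<in>S. x T \<in> T) \<and> m = (\<Sum>T\<in>S. x T)"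
        and uniq: "\<forall>x. (\<forall>T\<in>S. x T \<in> T) \<and> (\<Sum>T\<in>S. x T) = 0 \<longrightarrow> (\<forall>T\<in>S. x T = 0)"
        by (elim exE conjE) (rule that)
      have TS: "T \<notin> S"
      proof
        assume "T \<in> S"
        then have "T \<subseteq> T \<inter> Q" using S(2) unfolding M_def by blast
        then show False using Q(2) T'(3) subspace_0[OF sub[OF T'(1)]] by blast
      qed
      show ?thesis
      proof (intro exI[of _ "insert T S"] conjI allI impI ballI)
        show "finite (insert T S)" using S(1) by simp
        show "simple_submodule U" if "U \<in> insert T S" for U using that S(2) simple by auto
        show "U \<subseteq> N" if "U \<in> insert T S" for U using that S(2) T'(2) unfolding M_def by blast
      next
        fix m assume m: "m \<in> N"
        obtain p where p: "p \<in> T" "m - p \<in> Q" using spec[OF Q(3), of m] by blast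
        have "m - p \<in> N" using subspace_diff[OF sub[OF N] m] p(1) T'(2) by blast
        then have "m - p \<in> M" using p by (simp add: M_def)
        then obtain x where x: "\<forall>T\<in>S. x T \<in> T" "m - p = (\<Sum>T\<in>S. x T)"
          using bspec[OF ex] by blast
        have "(\<Sum>U\<in>S. (x(T := p)) U) = (\<Sum>U\<in>S. x U)"
          using TS by (intro sum.cong) auto
        then have "m = (\<Sum>U\<in>insert T S. (x(T := p)) U)"
          using TS S(1) x(2) by (simp add: algebra_simps)
        then show "\<exists>x. (\<forall>U\<in>insert T S. x U \<in> U) \<and> m = (\<Sum>U\<in>insert T S. x U)"
          using x(1) p(1) TS by (intro exI[of _ "x(T := p)"]) auto
      next
        fix x U assume x: "(\<forall>U\<in>insert T S. x U \<in> U) \<and> (\<Sum>U\<in>insert T S. x U) = 0" and U: "U \<in> insert T S"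
        have "(\<Sum>U\<in>S. x U) \<in> M"
          using x S(2) by (intro subspace_sum[OF sub[OF M]]) blast
        then have "- (\<Sum>U\<in>S. x U) \<in> M" by (rule subspace_neg[OF sub[OF M]])
        moreover have xT: "x T = - (\<Sum>U\<in>S. x U)"
          using x S(1) TS by (simp add: eq_neg_iff_add_eq_0)
        moreover have "x T \<in> T" using x by simp
        ultimately have "x T \<in> T \<inter> Q" unfolding M_def by simp
        then have xT0: "x T = 0" unfolding Q(2) by simp
        then have "(\<Sum>U\<in>S. x U) = 0" using xT by simp
        moreover have "\<forall>U\<in>S. x U \<in> U" using x by simp
        ultimately have "\<forall>U\<in>S. x U = 0" using spec[OF uniq, of x] by simp
        then show "x U = 0" using U xT0 by (elim insertE) simp_all
      qed
    qed
  qed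
qed

lemma completely_reducibleI:
  assumes "finite_dim"
    and "\<forall>N. is_submodule N \<longrightarrow> (\<exists>Q. is_submodule Q \<and> N \<inter> Q = {0} \<and> (\<forall>x. \<exists>p\<in>N. x - p \<in> Q))"
  shows completely_reducible
proof -
  have "is_submodule UNIV" by (simp add: is_submodule_def)
  from decomposition_into_simples[OF assms this] obtain S
    where S: "finite S" "\<forall>T\<in>S. simple_submodule T \<and> T \<subseteq> UNIV"
    and ex: "\<forall>m\<in>UNIV. \<exists>x. (\<forall>T\<in>S. x T \<in> T) \<and> m = (\<Sum>T\<in>S. x T)"
    and uniq: "\<forall>x. (\<forall>T\<in>S. x T \<in> T) \<and> (\<Sum>T\<in>S. x T) = 0 \<longrightarrow> (\<forall>T\<in>S. x T = 0)"
    by (elim exE conjE) (rule that)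
  have sub: "subspace T" if "T \<in> S" for T
    using S(2) that by (simp add: simple_submodule_def is_submodule_def)
  have supp: "(\<Sum>T | x T \<noteq> 0. x T) = (\<Sum>T\<in>S. x T)" if "\<forall>T. T \<notin> S \<longrightarrow> x T = 0" for x :: "'m set \<Rightarrow> 'm"
    using that S(1) by (intro sum.mono_neutral_left) auto
  have "is_direct_sum S (\<lambda>T. T)"
    unfolding is_direct_sum_def
  proof
    fix m
    obtain x where x: "\<forall>T\<in>S. x T \<in> T" "m = (\<Sum>T\<in>S. x T)" using bspec[OF ex, of m] by blast
    \<comment> \<open>\<open>is_direct_sum\<close> compares functions on all sets, so the components
      off \<open>S\<close> are set to 0 to make the family unique.\<close>
    define y where "y T = (if T \<in> S then x T else 0)" for T
    have y: "\<forall>T\<in>S. y T \<in> T" "\<forall>T. T \<notin> S \<longrightarrow> y T = 0" "m = (\<Sum>T\<in>S. y T)"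
      using x by (auto simp: y_def)
    show "\<exists>!x. (\<forall>T\<in>S. x T \<in> T) \<and> (\<forall>T. T \<notin> S \<longrightarrow> x T = 0) \<and> finite {T. x T \<noteq> 0} \<and> m = (\<Sum>T | x T \<noteq> 0. x T)"
    proof (rule ex1I[of _ y])
      have "{T. y T \<noteq> 0} \<subseteq> S" using y(2) by blast
      then show "(\<forall>T\<in>S. y T \<in> T) \<and> (\<forall>T. T \<notin> S \<longrightarrow> y T = 0) \<and> finite {T. y T \<noteq> 0} \<and> m = (\<Sum>T | y T \<noteq> 0. y T)"
        using y supp[OF y(2)] finite_subset[OF _ S(1)] by simp
    next
      fix z assume z: "(\<forall>T\<in>S. z T \<in> T) \<and> (\<forall>T. T \<notin> S \<longrightarrow> z T = 0) \<and> finite {T. z T \<noteq> 0} \<and> m = (\<Sum>T | z T \<noteq> 0. z T)"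
      then have "m = (\<Sum>T\<in>S. z T)" using supp[of z] by simp
      then have "(\<Sum>T\<in>S. z T - y T) = 0" using y(3) by (simp add: sum_subtractf)
      then have "\<forall>T\<in>S. z T - y T = 0"
        using z y(1) sub spec[OF uniq, of "\<lambda>T. z T - y T"] by (auto intro: subspace_diff)
      then show "z = y" using z y(2) by (auto simp: fun_eq_iff)
    qed
  qed
  then show ?thesis unfolding completely_reducible_def using S(2) by blast
qed

end

theorem theorem3p8:
  fixes n :: nat
    and r s :: "'k::alg_closed_field"
    and scale :: "'k \<Rightarrow> 'm::ab_group_add \<Rightarrow> 'm"
    and act :: "'k free_gl set \<Rightarrow> 'm \<Rightarrow> 'm"
  assumes "n \<ge> 1"
    and "r \<noteq> 0" and "s \<noteq> 0" and "r \<noteq> s"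
    and "\<not> (\<exists>k>0. (r * inverse s) ^ k = 1)"
    and "alg_module scale (Ugl n r s) (Ugl_const n r s) act"
    and "\<exists>m::'m. m \<noteq> 0"
    and "alg_module.finite_dim scale"
    and "alg_module.acts_semisimply scale act (Ugl0 n r s) (Ugl0_characters n r s)"
  shows "alg_module.completely_reducible scale (Ugl n r s) act"
proof -
  interpret Ugl_module scale n r s act
    using assms(6) by (rule Ugl_module.intro)
  obtain B where B: "finite B" "span B = UNIV"
    using assms(8) by (auto simp: finite_dim_def)
  interpret gl_rep scale n r s gact B
    by (rule gl_rep_gact[OF assms(2,3,5) B assms(9)])
  show ?thesis
  proof (rule completely_reducibleI[OF assms(8)], intro allI impI)
    fix N assume N: "is_submodule N"
    then have "subspace N" "\<forall>g\<in>gens n. \<forall>x\<in>N. gact g x \<in> N"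
      by (simp_all add: is_submodule_iff gact_def)
    from submodule_complement[OF this] obtain Q where
      "subspace Q \<and> (\<forall>g\<in>gens n. \<forall>x\<in>Q. gact g x \<in> Q)" "N \<inter> Q = {0}" "\<forall>x. \<exists>p\<in>N. x - p \<in> Q"
      by blast
    then show "\<exists>Q. is_submodule Q \<and> N \<inter> Q = {0} \<and> (\<forall>x. \<exists>p\<in>N. x - p \<in> Q)"
      by (intro exI[of _ Q]) (simp add: is_submodule_iff gact_def)
  qed
qed

end
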